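(* Let $(E,\mathcal{B},m)$ be a $\sigma$-finite measure space, $p\in(1,\infty)$, $p'=p/(p-1)$. Let $D_0^*$ be a dense linear subspace of $L^{p'}(m)$ and let $L_0^*\colon D_0^*\to L^{p'}(m)$ be a linear operator. Assume that for every $T\in(0,\infty)$ the linear span of $$\{\, f'\otimes\varphi+f\otimes L_0^*\varphi \;:\; \varphi\in D_0^*,\ f\in C^1([0,T];\mathbb{R}),\ f(T)=0 \,\}$$ is dense in $L^{p'}([0,T]\times E,\,dt\otimes m)$. Then the set $\mathcal{M}(L_0^*,D_0^* )$ contains at most one element.
   Context: All $L^p$-spaces are real. For $f\colon[0,T]\to\mathbb{R}$ and $\varphi\colon E\to\mathbb{R}$ put $(f\otimes\varphi)(t,x)=f(t)\varphi(x)$; thus $f'\otimes\varphi+f\otimes L_0^*\varphi=(\frac{\partial}{\partial s}+L_0^* )(f\otimes\varphi)$. A linear operator $L\colon D(L)\subset L^p(m)\to L^p(m)$ is called a generator on $L^p(m)$ if it is the generator of a strongly continuous semigroup $(e^{tL})_{t\ge0}$ of everywhere defined continuous linear operators on $L^p(m)$. For operators, $L_1\subset L_2$ means that the graph of $L_1$ is contained in the graph of $L_2$. $\mathcal{M}(L_0^*,D_0^* )$ is the set of all linear operators $L\colon D(L)\subset L^p(m)\to L^p(m)$ such that $L$ is a generator on $L^p(m)$ and $L_0^*\subset L^*$, where $L^*$ is the adjoint of $L$, acting on $L^{p'}(m)$. (Here $L_0^*$ is just the name of the given operator on $L^{p'}(m)$.) *)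

theory Defs
  imports "HOL-Analysis.Analysis"
begin

section \<open>The spaces \<open>L\<^sup>p(M)\<close>\<close>

text \<open>
  Elements of \<open>L\<^sup>p(M)\<close> are classes of real-valued measurable functions modulo equality almost
  everywhere. The operations on classes go through arbitrary representatives; the lemmas below show
  that the choice does not matter.
\<close>

definition ae_class :: "'a measure \<Rightarrow> ('a \<Rightarrow> real) \<Rightarrow> ('a \<Rightarrow> real) set" where
  "ae_class M f = {g \<in> borel_measurable M. AE x in M. g x = f x}"

definition rep :: "('a \<Rightarrow> real) set \<Rightarrow> 'a \<Rightarrow> real" where
  "rep X = (SOME f. f \<in> X)"

definition Lp_fun :: "real \<Rightarrow> 'a measure \<Rightarrow> ('a \<Rightarrow> real) set" where
  "Lp_fun p M = {f \<in> borel_measurable M. integrable M (\<lambda>x. \<bar>f x\<bar> powr p)}"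

definition Lp :: "real \<Rightarrow> 'a measure \<Rightarrow> ('a \<Rightarrow> real) set set" where
  "Lp p M = ae_class M ` Lp_fun p M"

definition Lp_add :: "'a measure \<Rightarrow> ('a \<Rightarrow> real) set \<Rightarrow> ('a \<Rightarrow> real) set \<Rightarrow> ('a \<Rightarrow> real) set" where
  "Lp_add M X Y = ae_class M (\<lambda>x. rep X x + rep Y x)"

definition Lp_scale :: "'a measure \<Rightarrow> real \<Rightarrow> ('a \<Rightarrow> real) set \<Rightarrow> ('a \<Rightarrow> real) set" where
  "Lp_scale M c X = ae_class M (\<lambda>x. c * rep X x)"

definition Lp_diff :: "'a measure \<Rightarrow> ('a \<Rightarrow> real) set \<Rightarrow> ('a \<Rightarrow> real) set \<Rightarrow> ('a \<Rightarrow> real) set" where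
  "Lp_diff M X Y = ae_class M (\<lambda>x. rep X x - rep Y x)"

definition Lp_zero :: "'a measure \<Rightarrow> ('a \<Rightarrow> real) set" where
  "Lp_zero M = ae_class M (\<lambda>x. 0)"

definition Lp_dist :: "real \<Rightarrow> 'a measure \<Rightarrow> ('a \<Rightarrow> real) set \<Rightarrow> ('a \<Rightarrow> real) set \<Rightarrow> real" where
  "Lp_dist p M X Y = (\<integral>x. \<bar>rep X x - rep Y x\<bar> powr p \<partial>M) powr (1 / p)"

definition Lp_topology :: "real \<Rightarrow> 'a measure \<Rightarrow> ('a \<Rightarrow> real) set topology" where
  "Lp_topology p M = Metric_space.mtopology (Lp p M) (Lp_dist p M)"

definition Lp_pairing :: "'a measure \<Rightarrow> ('a \<Rightarrow> real) set \<Rightarrow> ('a \<Rightarrow> real) set \<Rightarrow> real" where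
  "Lp_pairing M X Y = (\<integral>x. rep X x * rep Y x \<partial>M)"

definition conj_exp :: "real \<Rightarrow> real" where
  "conj_exp p = p / (p - 1)"

definition Lp_subspace :: "real \<Rightarrow> 'a measure \<Rightarrow> ('a \<Rightarrow> real) set set \<Rightarrow> bool" where
  "Lp_subspace p M S \<longleftrightarrow> S \<subseteq> Lp p M \<and> Lp_zero M \<in> S \<and>
     (\<forall>X\<in>S. \<forall>Y\<in>S. Lp_add M X Y \<in> S) \<and> (\<forall>c. \<forall>X\<in>S. Lp_scale M c X \<in> S)"

definition Lp_span :: "real \<Rightarrow> 'a measure \<Rightarrow> ('a \<Rightarrow> real) set set \<Rightarrow> ('a \<Rightarrow> real) set set" where
  "Lp_span p M S = Lp_subspace p M hull S"

definition Lp_dense :: "real \<Rightarrow> 'a measure \<Rightarrow> ('a \<Rightarrow> real) set set \<Rightarrow> bool" where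
  "Lp_dense p M S \<longleftrightarrow> S \<subseteq> Lp p M \<and> Lp_topology p M closure_of S = Lp p M"

subsection \<open>Independence of representatives, and the metric of \<open>L\<^sup>p(M)\<close>\<close>

lemma rep_ae_class:
  assumes "f \<in> borel_measurable M"
  shows "rep (ae_class M f) \<in> borel_measurable M" "AE x in M. rep (ae_class M f) x = f x"
proof -
  have "f \<in> ae_class M f"
    using assms by (simp add: ae_class_def)
  then have "rep (ae_class M f) \<in> ae_class M f"
    unfolding rep_def by (rule someI[of "\<lambda>h. h \<in> ae_class M f"])
  then show "rep (ae_class M f) \<in> borel_measurable M" "AE x in M. rep (ae_class M f) x = f x"
    by (auto simp: ae_class_def)
qed

lemma ae_class_eq_iff:
  assumes "f \<in> borel_measurable M" "g \<in> borel_measurable M"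
  shows "ae_class M f = ae_class M g \<longleftrightarrow> (AE x in M. f x = g x)"
proof
  assume "ae_class M f = ae_class M g"
  moreover have "f \<in> ae_class M f"
    using assms by (simp add: ae_class_def)
  ultimately show "AE x in M. f x = g x"
    by (auto simp: ae_class_def)
next
  assume *: "AE x in M. f x = g x"
  have "(AE x in M. h x = f x) \<longleftrightarrow> (AE x in M. h x = g x)" for h
    using * by (auto elim: AE_mp)
  then show "ae_class M f = ae_class M g"
    by (simp add: ae_class_def)
qed

lemma Lp_fun_cong_AE:
  assumes "f \<in> Lp_fun p M" "g \<in> borel_measurable M" "AE x in M. g x = f x"
  shows "g \<in> Lp_fun p M"
proof -
  have "integrable M (\<lambda>x. \<bar>g x\<bar> powr p) \<longleftrightarrow> integrable M (\<lambda>x. \<bar>f x\<bar> powr p)"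
    using assms by (intro integrable_cong_AE) (auto simp: Lp_fun_def)
  then show ?thesis
    using assms by (simp add: Lp_fun_def)
qed

lemma rep_Lp:
  assumes "X \<in> Lp p M"
  shows "rep X \<in> Lp_fun p M" "ae_class M (rep X) = X"
proof -
  obtain f where f: "f \<in> Lp_fun p M" "X = ae_class M f"
    using assms by (auto simp: Lp_def)
  then have m: "f \<in> borel_measurable M"
    by (simp add: Lp_fun_def)
  show "rep X \<in> Lp_fun p M"
    using f rep_ae_class[OF m] by (metis Lp_fun_cong_AE)
  show "ae_class M (rep X) = X"
    unfolding f(2) by (subst ae_class_eq_iff) (use rep_ae_class[OF m] m in auto)
qed

lemma Lp_add_ae_class:
  assumes "f \<in> borel_measurable M" "g \<in> borel_measurable M"
  shows "Lp_add M (ae_class M f) (ae_class M g) = ae_class M (\<lambda>x. f x + g x)"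
  unfolding Lp_add_def
  by (subst ae_class_eq_iff) (use assms rep_ae_class[of f M] rep_ae_class[of g M] in auto)

lemma Lp_diff_ae_class:
  assumes "f \<in> borel_measurable M" "g \<in> borel_measurable M"
  shows "Lp_diff M (ae_class M f) (ae_class M g) = ae_class M (\<lambda>x. f x - g x)"
  unfolding Lp_diff_def
  by (subst ae_class_eq_iff) (use assms rep_ae_class[of f M] rep_ae_class[of g M] in auto)

lemma Lp_scale_ae_class:
  assumes "f \<in> borel_measurable M"
  shows "Lp_scale M c (ae_class M f) = ae_class M (\<lambda>x. c * f x)"
  unfolding Lp_scale_def
  by (subst ae_class_eq_iff) (use assms rep_ae_class[of f M] in auto)

lemma Lp_dist_ae_class:
  assumes "f \<in> borel_measurable M" "g \<in> borel_measurable M"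
  shows "Lp_dist p M (ae_class M f) (ae_class M g) = (\<integral>x. \<bar>f x - g x\<bar> powr p \<partial>M) powr (1 / p)"
proof -
  have "(\<integral>x. \<bar>rep (ae_class M f) x - rep (ae_class M g) x\<bar> powr p \<partial>M) = (\<integral>x. \<bar>f x - g x\<bar> powr p \<partial>M)"
    by (rule integral_cong_AE)
      (use assms rep_ae_class[of f M] rep_ae_class[of g M] in auto)
  then show ?thesis
    by (simp add: Lp_dist_def)
qed

lemma Lp_pairing_ae_class:
  assumes "f \<in> borel_measurable M" "g \<in> borel_measurable M"
  shows "Lp_pairing M (ae_class M f) (ae_class M g) = (\<integral>x. f x * g x \<partial>M)"
  unfolding Lp_pairing_def
  by (rule integral_cong_AE)
    (use assms rep_ae_class[of f M] rep_ae_class[of g M] in auto)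

lemma powr_convex_nonneg:
  fixes u v s t p :: real
  assumes "1 \<le> p" "0 \<le> u" "0 \<le> v" "0 \<le> s" "0 \<le> t" "s + t = 1"
  shows "(s * u + t * v) powr p \<le> s * u powr p + t * v powr p"
proof -
  have shrink: "r powr p \<le> r" if "0 \<le> r" "r \<le> 1" for r :: real
    using that assms(1) powr_mono'[of 1 p r] by (cases "r = 0") auto
  consider "u = 0" | "v = 0" | "u > 0" "v > 0"
    using assms by linarith
  then show ?thesis
  proof cases
    case 1
    then show ?thesis
      using assms shrink[of t] by (simp add: powr_mult mult_right_mono)
  next
    case 2
    then show ?thesis
      using assms shrink[of s] by (simp add: powr_mult mult_right_mono)
  next
    case 3
    have "s = 1 - t"
      using assms(6) by simp
    then show ?thesis
      using convex_onD[OF powr_convex[OF assms(1)], of t u v] assms(4,5) 3 by simp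
  qed
qed

lemma Lp_fun_add:
  assumes p: "1 \<le> p" and f: "f \<in> Lp_fun p M" and g: "g \<in> Lp_fun p M"
  shows "(\<lambda>x. f x + g x) \<in> Lp_fun p M"
proof -
  have [measurable]: "f \<in> borel_measurable M" "g \<in> borel_measurable M"
    using f g by (auto simp: Lp_fun_def)
  have bound: "\<bar>f x + g x\<bar> powr p \<le> 2 powr p * (\<bar>f x\<bar> powr p + \<bar>g x\<bar> powr p)" for x
  proof -
    have "\<bar>f x + g x\<bar> powr p \<le> (2 * (1/2 * \<bar>f x\<bar> + 1/2 * \<bar>g x\<bar>)) powr p"
      using p by (intro powr_mono2) auto
    also have "\<dots> = 2 powr p * (1/2 * \<bar>f x\<bar> + 1/2 * \<bar>g x\<bar>) powr p"
      by (subst powr_mult) auto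
    also have "\<dots> \<le> 2 powr p * (1/2 * \<bar>f x\<bar> powr p + 1/2 * \<bar>g x\<bar> powr p)"
      using powr_convex_nonneg[OF p, of "\<bar>f x\<bar>" "\<bar>g x\<bar>" "1/2" "1/2"]
      by (intro mult_left_mono) auto
    also have "\<dots> \<le> 2 powr p * (\<bar>f x\<bar> powr p + \<bar>g x\<bar> powr p)"
      by (intro mult_left_mono add_mono) auto
    finally show ?thesis .
  qed
  have "integrable M (\<lambda>x. 2 powr p * (\<bar>f x\<bar> powr p + \<bar>g x\<bar> powr p))"
    using f g by (auto simp: Lp_fun_def)
  then have "integrable M (\<lambda>x. \<bar>f x + g x\<bar> powr p)"
    by (rule Bochner_Integration.integrable_bound) (use bound in auto)
  then show ?thesis
    by (simp add: Lp_fun_def)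
qed

lemma Lp_fun_scale:
  assumes "f \<in> Lp_fun p M"
  shows "(\<lambda>x. c * f x) \<in> Lp_fun p M"
  using assms by (auto simp: Lp_fun_def abs_mult powr_mult)

lemma Lp_fun_diff:
  assumes "1 \<le> p" "f \<in> Lp_fun p M" "g \<in> Lp_fun p M"
  shows "(\<lambda>x. f x - g x) \<in> Lp_fun p M"
  using Lp_fun_add[OF assms(1,2) Lp_fun_scale[OF assms(3), of "-1"]] by simp

lemma Minkowski_inequality:
  assumes p: "1 \<le> p" and f: "f \<in> Lp_fun p M" and g: "g \<in> Lp_fun p M"
  shows "(\<integral>x. \<bar>f x + g x\<bar> powr p \<partial>M) powr (1 / p)
    \<le> (\<integral>x. \<bar>f x\<bar> powr p \<partial>M) powr (1 / p) + (\<integral>x. \<bar>g x\<bar> powr p \<partial>M) powr (1 / p)"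
proof -
  have [measurable]: "f \<in> borel_measurable M" "g \<in> borel_measurable M"
    and int: "integrable M (\<lambda>x. \<bar>f x\<bar> powr p)" "integrable M (\<lambda>x. \<bar>g x\<bar> powr p)"
    using f g by (auto simp: Lp_fun_def)
  have int': "integrable M (\<lambda>x. \<bar>f x + g x\<bar> powr p)"
    using Lp_fun_add[OF p f g] by (auto simp: Lp_fun_def)
  define a where "a = (\<integral>x. \<bar>f x\<bar> powr p \<partial>M) powr (1 / p)"
  define b where "b = (\<integral>x. \<bar>g x\<bar> powr p \<partial>M) powr (1 / p)"
  have ab: "0 \<le> a" "0 \<le> b"
    by (auto simp: a_def b_def)
  have ap: "(\<integral>x. \<bar>f x\<bar> powr p \<partial>M) = a powr p" and bp: "(\<integral>x. \<bar>g x\<bar> powr p \<partial>M) = b powr p"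
    using p by (auto simp: a_def b_def powr_powr)
  have null: "AE x in M. h x = 0" if "integrable M (\<lambda>x. \<bar>h x\<bar> powr p)" "(\<integral>x. \<bar>h x\<bar> powr p \<partial>M) = 0"
    for h :: "'a \<Rightarrow> real"
    using integral_nonneg_eq_0_iff_AE[OF that(1)] that(2) by auto
  consider "a = 0" | "b = 0" | "a > 0" "b > 0"
    using ab by linarith
  then show ?thesis
  proof cases
    case 1
    then have "AE x in M. f x = 0"
      using null[OF int(1)] ap p by simp
    then have "(\<integral>x. \<bar>f x + g x\<bar> powr p \<partial>M) = (\<integral>x. \<bar>g x\<bar> powr p \<partial>M)"
      by (intro integral_cong_AE) auto
    then show ?thesis by simp
  next
    case 2
    then have "AE x in M. g x = 0"
      using null[OF int(2)] bp p by simp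
    then have "(\<integral>x. \<bar>f x + g x\<bar> powr p \<partial>M) = (\<integral>x. \<bar>f x\<bar> powr p \<partial>M)"
      by (intro integral_cong_AE) auto
    then show ?thesis by simp
  next
    case 3
    define s t where "s = a / (a + b)" and "t = b / (a + b)"
    have st: "0 \<le> s" "0 \<le> t" "s + t = 1"
      using 3 by (auto simp: s_def t_def add_divide_distrib[symmetric])
    have bound: "\<bar>f x + g x\<bar> powr p
        \<le> (a + b) powr p * (s * (\<bar>f x\<bar> powr p / a powr p) + t * (\<bar>g x\<bar> powr p / b powr p))" for x
    proof -
      have eq: "(a + b) * (s * (\<bar>f x\<bar> / a) + t * (\<bar>g x\<bar> / b)) = \<bar>f x\<bar> + \<bar>g x\<bar>"
      proof -
        have "(a + b) * s = a" "(a + b) * t = b"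
          using 3 by (auto simp: s_def t_def)
        then have "(a + b) * (s * u + t * v) = a * u + b * v" for u v
          by (metis distrib_left mult.assoc)
        from this[of "\<bar>f x\<bar> / a" "\<bar>g x\<bar> / b"] show ?thesis
          using 3 by (simp del: times_divide_eq_right)
            (simp only: times_divide_eq_right, simp)
      qed
      have "\<bar>f x + g x\<bar> powr p \<le> ((a + b) * (s * (\<bar>f x\<bar> / a) + t * (\<bar>g x\<bar> / b))) powr p"
        unfolding eq using p by (intro powr_mono2) auto
      also have "\<dots> = (a + b) powr p * (s * (\<bar>f x\<bar> / a) + t * (\<bar>g x\<bar> / b)) powr p"
        using 3 st by (subst powr_mult) auto
      also have "\<dots> \<le> (a + b) powr p * (s * (\<bar>f x\<bar> / a) powr p + t * (\<bar>g x\<bar> / b) powr p)"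
        using 3 st p by (intro mult_left_mono powr_convex_nonneg) auto
      finally show ?thesis
        using 3 by (simp add: powr_divide)
    qed
    have "(\<integral>x. \<bar>f x + g x\<bar> powr p \<partial>M) \<le>
        (\<integral>x. (a + b) powr p * (s * (\<bar>f x\<bar> powr p / a powr p) + t * (\<bar>g x\<bar> powr p / b powr p)) \<partial>M)"
      by (rule integral_mono) (use int int' bound in auto)
    also have "\<dots> = (a + b) powr p"
      using int 3 st by (simp add: ap bp)
    finally have "(\<integral>x. \<bar>f x + g x\<bar> powr p \<partial>M) powr (1 / p) \<le> ((a + b) powr p) powr (1 / p)"
      using p by (intro powr_mono2) auto
    also have "\<dots> = a + b"
      using p 3 by (simp add: powr_powr)
    finally show ?thesis
      by (simp add: a_def b_def)
  qed
qed

lemma Metric_space_Lp: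
  assumes p: "1 \<le> p"
  shows "Metric_space (Lp p M) (Lp_dist p M)"
proof
  fix X Y
  show "0 \<le> Lp_dist p M X Y"
    by (simp add: Lp_dist_def)
  show "Lp_dist p M X Y = Lp_dist p M Y X"
    by (simp add: Lp_dist_def abs_minus_commute)
next
  fix X Y assume XY: "X \<in> Lp p M" "Y \<in> Lp p M"
  note m = rep_Lp(1)[OF XY(1)] rep_Lp(1)[OF XY(2)]
  have [measurable]: "rep X \<in> borel_measurable M" "rep Y \<in> borel_measurable M"
    using m by (auto simp: Lp_fun_def)
  have int: "integrable M (\<lambda>x. \<bar>rep X x - rep Y x\<bar> powr p)"
    using Lp_fun_diff[OF p m] by (simp add: Lp_fun_def)
  have "Lp_dist p M X Y = 0 \<longleftrightarrow> (AE x in M. rep X x = rep Y x)"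
    using integral_nonneg_eq_0_iff_AE[OF int] p by (simp add: Lp_dist_def)
  also have "\<dots> \<longleftrightarrow> X = Y"
    using ae_class_eq_iff[of "rep X" M "rep Y"] rep_Lp(2)[OF XY(1)] rep_Lp(2)[OF XY(2)] by simp
  finally show "Lp_dist p M X Y = 0 \<longleftrightarrow> X = Y" .
next
  fix X Y Z assume XYZ: "X \<in> Lp p M" "Y \<in> Lp p M" "Z \<in> Lp p M"
  note m = rep_Lp(1)[OF XYZ(1)] rep_Lp(1)[OF XYZ(2)] rep_Lp(1)[OF XYZ(3)]
  show "Lp_dist p M X Z \<le> Lp_dist p M X Y + Lp_dist p M Y Z"
    using Minkowski_inequality[OF p Lp_fun_diff[OF p m(1,2)] Lp_fun_diff[OF p m(2,3)]]
    by (simp add: Lp_dist_def)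
qed

lemma topspace_Lp_topology [simp]: "1 \<le> p \<Longrightarrow> topspace (Lp_topology p M) = Lp p M"
  by (simp add: Lp_topology_def Metric_space.topspace_mtopology Metric_space_Lp)

lemma ae_class_in_Lp: "f \<in> Lp_fun p M \<Longrightarrow> ae_class M f \<in> Lp p M"
  by (simp add: Lp_def)

lemma Lp_subspace_Lp:
  assumes "1 \<le> p"
  shows "Lp_subspace p M (Lp p M)"
  unfolding Lp_subspace_def Lp_zero_def Lp_add_def Lp_scale_def
  using assms by (auto intro!: ae_class_in_Lp Lp_fun_add Lp_fun_scale rep_Lp) (auto simp: Lp_fun_def)

section \<open>Operators and semigroups on \<open>L\<^sup>p(M)\<close>\<close>

definition Lp_linear_on ::
  "real \<Rightarrow> 'a measure \<Rightarrow> ('a \<Rightarrow> real) set set \<Rightarrow> (('a \<Rightarrow> real) set \<Rightarrow> ('a \<Rightarrow> real) set) \<Rightarrow> bool" where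
  "Lp_linear_on p M D A \<longleftrightarrow> Lp_subspace p M D \<and> A ` D \<subseteq> Lp p M \<and>
     (\<forall>X\<in>D. \<forall>Y\<in>D. A (Lp_add M X Y) = Lp_add M (A X) (A Y)) \<and>
     (\<forall>c. \<forall>X\<in>D. A (Lp_scale M c X) = Lp_scale M c (A X))"

text \<open>
  A partially defined operator \<open>L\<close> is identified with its graph, so that its domain is
  \<^const>\<open>Domain\<close> \<open>L\<close> and inclusion of operators is inclusion of sets.
\<close>

type_synonym 'a Lp_operator = "(('a \<Rightarrow> real) set \<times> ('a \<Rightarrow> real) set) set"

definition op_graph ::
  "('a \<Rightarrow> real) set set \<Rightarrow> (('a \<Rightarrow> real) set \<Rightarrow> ('a \<Rightarrow> real) set) \<Rightarrow> 'a Lp_operator" where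
  "op_graph D A = {(X, A X) | X. X \<in> D}"

definition Lp_linear_operator :: "real \<Rightarrow> 'a measure \<Rightarrow> 'a Lp_operator \<Rightarrow> bool" where
  "Lp_linear_operator p M L \<longleftrightarrow> (\<exists>D A. Lp_linear_on p M D A \<and> L = op_graph D A)"

text \<open>
  The dual of \<open>L\<^sup>p(M)\<close> is identified with \<open>L\<^sup>p\<^sup>'(M)\<close> through the integral pairing. The relation below
  is the graph of a map as soon as \<open>L\<close> is densely defined, which generators are.
\<close>

definition Lp_adjoint :: "real \<Rightarrow> 'a measure \<Rightarrow> 'a Lp_operator \<Rightarrow> 'a Lp_operator" where
  "Lp_adjoint p M L = {(Y, Z). Y \<in> Lp (conj_exp p) M \<and> Z \<in> Lp (conj_exp p) M \<and>
     (\<forall>(X, W) \<in> L. Lp_pairing M W Y = Lp_pairing M X Z)}"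

text \<open>Only the values \<open>T t\<close> with \<open>0 \<le> t\<close>, restricted to \<open>L\<^sup>p(M)\<close>, matter below.\<close>

definition C0_semigroup ::
  "real \<Rightarrow> 'a measure \<Rightarrow> (real \<Rightarrow> ('a \<Rightarrow> real) set \<Rightarrow> ('a \<Rightarrow> real) set) \<Rightarrow> bool" where
  "C0_semigroup p M T \<longleftrightarrow>
     (\<forall>t\<ge>0. Lp_linear_on p M (Lp p M) (T t) \<and>
             continuous_map (Lp_topology p M) (Lp_topology p M) (T t)) \<and>
     (\<forall>X\<in>Lp p M. T 0 X = X) \<and>
     (\<forall>s\<ge>0. \<forall>t\<ge>0. \<forall>X\<in>Lp p M. T (s + t) X = T s (T t X)) \<and>
     (\<forall>X\<in>Lp p M. continuous_map (top_of_set {0..}) (Lp_topology p M) (\<lambda>t. T t X))"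

definition semigroup_generator ::
  "real \<Rightarrow> 'a measure \<Rightarrow> (real \<Rightarrow> ('a \<Rightarrow> real) set \<Rightarrow> ('a \<Rightarrow> real) set) \<Rightarrow> 'a Lp_operator" where
  "semigroup_generator p M T = {(X, Y). X \<in> Lp p M \<and>
     limitin (Lp_topology p M) (\<lambda>h. Lp_scale M (1 / h) (Lp_diff M (T h X) X)) Y (at_right 0)}"

definition is_generator :: "real \<Rightarrow> 'a measure \<Rightarrow> 'a Lp_operator \<Rightarrow> bool" where
  "is_generator p M L \<longleftrightarrow> (\<exists>T. C0_semigroup p M T \<and> L = semigroup_generator p M T)"

definition generator_extensions ::
  "real \<Rightarrow> 'a measure \<Rightarrow> (('a \<Rightarrow> real) set \<Rightarrow> ('a \<Rightarrow> real) set) \<Rightarrow> ('a \<Rightarrow> real) set set \<Rightarrow>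
   'a Lp_operator set" where
  "generator_extensions p M L0 D0 =
     {L. Lp_linear_operator p M L \<and> is_generator p M L \<and> op_graph D0 L0 \<subseteq> Lp_adjoint p M L}"

section \<open>Test functions on \<open>[0,T] \<times> E\<close>\<close>

definition time_space :: "real \<Rightarrow> 'a measure \<Rightarrow> (real \<times> 'a) measure" where
  "time_space T M = restrict_space lborel {0..T} \<Otimes>\<^sub>M M"

definition tensor ::
  "real \<Rightarrow> 'a measure \<Rightarrow> (real \<Rightarrow> real) \<Rightarrow> ('a \<Rightarrow> real) set \<Rightarrow> (real \<times> 'a \<Rightarrow> real) set" where
  "tensor T M f \<phi> = ae_class (time_space T M) (\<lambda>(t, x). f t * rep \<phi> x)"

text \<open>\<open>f \<in> C\<^sup>1([0,T])\<close> with derivative \<open>f'\<close>, one-sided at the end points.\<close>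

definition C1_with_deriv :: "real \<Rightarrow> (real \<Rightarrow> real) \<Rightarrow> (real \<Rightarrow> real) \<Rightarrow> bool" where
  "C1_with_deriv T f f' \<longleftrightarrow>
     (\<forall>t\<in>{0..T}. (f has_real_derivative f' t) (at t within {0..T})) \<and> continuous_on {0..T} f'"

definition parabolic_test_set ::
  "real \<Rightarrow> 'a measure \<Rightarrow> (('a \<Rightarrow> real) set \<Rightarrow> ('a \<Rightarrow> real) set) \<Rightarrow> ('a \<Rightarrow> real) set set \<Rightarrow>
   (real \<times> 'a \<Rightarrow> real) set set" where
  "parabolic_test_set T M L0 D0 =
     {Lp_add (time_space T M) (tensor T M f' \<phi>) (tensor T M f (L0 \<phi>)) | \<phi> f f'.
        \<phi> \<in> D0 \<and> C1_with_deriv T f f' \<and> f T = 0}"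

lemma tensor_in_Lp:
  assumes M: "sigma_finite_measure M" and p: "1 \<le> p"
    and f: "continuous_on {0..T} f" and \<phi>: "\<phi> \<in> Lp p M"
  shows "tensor T M f \<phi> \<in> Lp p (time_space T M)"
proof -
  let ?I = "restrict_space lborel {0..T} :: real measure"
  interpret M: sigma_finite_measure M by fact
  interpret I: finite_measure ?I
    by (rule finite_measureI) (cases "0 \<le> T"; simp add: space_restrict_space emeasure_restrict_space)
  interpret pair_sigma_finite ?I M ..
  have fm [measurable]: "f \<in> borel_measurable ?I"
    using borel_measurable_continuous_on_restrict[OF f]
    by (simp cong: measurable_cong_sets add: sets_restrict_space)
  have r: "rep \<phi> \<in> borel_measurable M" "integrable M (\<lambda>x. \<bar>rep \<phi> x\<bar> powr p)"
    using rep_Lp(1)[OF \<phi>] by (auto simp: Lp_fun_def)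
  note r(1) [measurable]
  obtain B where B: "\<And>t. t \<in> {0..T} \<Longrightarrow> \<bar>f t\<bar> \<le> B"
    using compact_imp_bounded[OF compact_continuous_image[OF f]]
    by (force simp: bounded_iff)
  have fi: "integrable ?I (\<lambda>t. \<bar>f t\<bar> powr p)"
    by (rule I.integrable_const_bound[of _ "B powr p"])
      (use B p in \<open>auto simp: space_restrict_space intro!: powr_mono2\<close>)
  have "integrable (?I \<Otimes>\<^sub>M M) (\<lambda>(t, x). \<bar>f t\<bar> powr p * \<bar>rep \<phi> x\<bar> powr p)"
    by (rule Fubini_integrable) (use fi r in \<open>auto simp: abs_mult\<close>)
  then have "(\<lambda>(t, x). f t * rep \<phi> x) \<in> Lp_fun p (time_space T M)"
    by (simp add: Lp_fun_def time_space_def case_prod_unfold abs_mult powr_mult)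
  then show ?thesis
    by (simp add: tensor_def ae_class_in_Lp)
qed

text \<open>Hence the linear span of the test set is formed inside \<open>L\<^sup>p([0,T] \<times> E)\<close>.\<close>

lemma parabolic_test_set_subset_Lp:
  assumes "sigma_finite_measure M" and p: "1 \<le> p" and L0: "Lp_linear_on p M D0 L0"
  shows "parabolic_test_set T M L0 D0 \<subseteq> Lp p (time_space T M)"
proof -
  have "Lp_add (time_space T M) (tensor T M f' \<phi>) (tensor T M f (L0 \<phi>)) \<in> Lp p (time_space T M)"
    if "\<phi> \<in> D0" "C1_with_deriv T f f'" for f f' \<phi>
  proof -
    have "continuous_on {0..T} f" "continuous_on {0..T} f'"
      using that(2) by (auto simp: C1_with_deriv_def intro!: DERIV_continuous_on)
    moreover have "\<phi> \<in> Lp p M" "L0 \<phi> \<in> Lp p M"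
      using that(1) L0 by (auto simp: Lp_linear_on_def Lp_subspace_def)
    ultimately show ?thesis
      using Lp_subspace_Lp[OF p, of "time_space T M"] assms(1) p
      by (auto simp: Lp_subspace_def tensor_in_Lp)
  qed
  then show ?thesis
    by (auto simp: parabolic_test_set_def)
qed

end

theory Submission
  imports Defs
begin

text \<open>
  Let \<open>u\<^sub>i(t) = T\<^sub>i(t) X\<close> be the orbits of one vector under the two semigroups. Since
  \<open>\<integral>\<^sub>0\<^sup>t u\<^sub>i(s) ds\<close> lies in the domain of the generator and is mapped to \<open>u\<^sub>i(t) - X\<close>, pairing
  with \<open>\<phi> \<in> D\<^sub>0\<close> gives \<open>\<langle>u\<^sub>i(t), \<phi>\<rangle> - \<langle>X, \<phi>\<rangle> = \<integral>\<^sub>0\<^sup>t \<langle>u\<^sub>i(s), L\<^sub>0 \<phi>\<rangle> ds\<close>. Integration by parts then shows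
  that \<open>\<integral>\<integral> u\<^sub>i (f' \<otimes> \<phi> + f \<otimes> L\<^sub>0 \<phi>) = - f(0) \<langle>X, \<phi>\<rangle>\<close> does not depend on \<open>i\<close>. Hence \<open>u\<^sub>1 - u\<^sub>2\<close>
  annihilates a dense subspace of \<open>L\<^sup>p\<^sup>'([0,T] \<times> E)\<close> and vanishes, so the semigroups, and with them their
  generators, coincide. All integrals of orbits are taken pointwise, with a jointly measurable
  version of \<open>(t, x) \<mapsto> u\<^sub>i(t)(x)\<close> obtained as an almost everywhere limit of step functions in \<open>t\<close>.
\<close>

section \<open>Norms and metrics\<close>

text \<open>Taken on functions rather than classes, because sections of a joint version are
  estimated before they are turned into classes. If the power of \<open>f\<close> is not integrable,
  the integral has its default value 0; this is why a vanishing norm is exploited only inside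
  \<open>Lp_fun\<close>.\<close>

definition Lp_norm :: "real \<Rightarrow> 'a measure \<Rightarrow> ('a \<Rightarrow> real) \<Rightarrow> real" where
  "Lp_norm p M f = (\<integral>x. \<bar>f x\<bar> powr p \<partial>M) powr (1 / p)"

lemma Lp_norm_nonneg [simp]: "0 \<le> Lp_norm p M f"
  by (simp add: Lp_norm_def)

lemma Lp_norm_powr: "0 < p \<Longrightarrow> Lp_norm p M f powr p = (\<integral>x. \<bar>f x\<bar> powr p \<partial>M)"
  by (simp add: Lp_norm_def powr_powr)

lemma Lp_norm_leI:
  assumes "0 < p" "0 \<le> C" "(\<integral>x. \<bar>f x\<bar> powr p \<partial>M) \<le> C powr p"
  shows "Lp_norm p M f \<le> C"
proof -
  have "Lp_norm p M f \<le> (C powr p) powr (1 / p)"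
    unfolding Lp_norm_def using assms by (intro powr_mono2) auto
  then show ?thesis
    using assms by (simp add: powr_powr)
qed

lemma Lp_norm_cong_AE:
  assumes "f \<in> borel_measurable M" "g \<in> borel_measurable M" "AE x in M. f x = g x"
  shows "Lp_norm p M f = Lp_norm p M g"
proof -
  have "(\<integral>x. \<bar>f x\<bar> powr p \<partial>M) = (\<integral>x. \<bar>g x\<bar> powr p \<partial>M)"
    by (rule integral_cong_AE) (use assms in auto)
  then show ?thesis
    by (simp add: Lp_norm_def)
qed

lemma Lp_norm_eq_0_AE:
  assumes p: "0 < p" and f: "f \<in> Lp_fun p M" and "Lp_norm p M f = 0"
  shows "AE x in M. f x = 0"
proof -
  have "(\<integral>x. \<bar>f x\<bar> powr p \<partial>M) = 0"
    using assms by (simp add: Lp_norm_def)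
  then show ?thesis
    using integral_nonneg_eq_0_iff_AE[of M "\<lambda>x. \<bar>f x\<bar> powr p"] f by (auto simp: Lp_fun_def)
qed

lemma Lp_fun_measurable: "f \<in> Lp_fun p M \<Longrightarrow> f \<in> borel_measurable M"
  by (simp add: Lp_fun_def)

section \<open>Conjugate exponents, Hoelder's inequality and integrals over a time interval\<close>

lemma conj_exp_gt_1: "1 < p \<Longrightarrow> 1 < conj_exp p"
  by (simp add: conj_exp_def field_simps)

lemma conj_exp_inverse_sum: "1 < p \<Longrightarrow> 1 / p + 1 / conj_exp p = 1"
  by (simp add: conj_exp_def field_simps)

text \<open>Young's inequality supplies an integrable majorant of the product.\<close>

lemma Holder_integrable:
  assumes p: "1 < p" and f: "f \<in> Lp_fun p M" and g: "g \<in> Lp_fun (conj_exp p) M"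
  shows "integrable M (\<lambda>x. f x * g x)"
proof (rule Bochner_Integration.integrable_bound)
  have [measurable]: "f \<in> borel_measurable M" "g \<in> borel_measurable M"
    using f g by (auto simp: Lp_fun_def)
  show "integrable M (\<lambda>x. \<bar>f x\<bar> powr p / p + \<bar>g x\<bar> powr conj_exp p / conj_exp p)"
    using f g by (auto simp: Lp_fun_def)
  have "\<bar>f x * g x\<bar> \<le> \<bar>f x\<bar> powr p / p + \<bar>g x\<bar> powr conj_exp p / conj_exp p" for x
    unfolding abs_mult
    using p by (intro Youngs_inequality conj_exp_gt_1 conj_exp_inverse_sum) auto
  then show "AE x in M. norm (f x * g x) \<le> norm (\<bar>f x\<bar> powr p / p + \<bar>g x\<bar> powr conj_exp p / conj_exp p)"
    by (intro AE_I2) (force intro: order_trans[OF _ abs_ge_self])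
  show "(\<lambda>x. f x * g x) \<in> borel_measurable M"
    by measurable
qed

text \<open>Young's inequality is applied to the normalised functions \<open>f / a\<close> and
  \<open>g / b\<close>; after integration the weights \<open>1 / p\<close> and \<open>1 / q\<close>
  add up to 1. If a norm vanishes there is nothing to divide by, but then the product is zero almost
  everywhere.\<close>

lemma Holder_inequality_abs:
  assumes p: "1 < p" and f: "f \<in> Lp_fun p M" and g: "g \<in> Lp_fun (conj_exp p) M"
  shows "(\<integral>x. \<bar>f x * g x\<bar> \<partial>M) \<le> Lp_norm p M f * Lp_norm (conj_exp p) M g"
proof -
  define q where "q = conj_exp p"
  have q: "1 < q" "1 / p + 1 / q = 1"
    using p by (auto simp: q_def conj_exp_gt_1 conj_exp_inverse_sum)
  note g = g[folded q_def]
  have [measurable]: "f \<in> borel_measurable M" "g \<in> borel_measurable M"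
    using f g by (auto simp: Lp_fun_def)
  define a b where "a = Lp_norm p M f" and "b = Lp_norm q M g"
  have ab: "0 \<le> a" "0 \<le> b"
    by (auto simp: a_def b_def)
  have int: "integrable M (\<lambda>x. \<bar>f x\<bar> powr p)" "integrable M (\<lambda>x. \<bar>g x\<bar> powr q)"
    "integrable M (\<lambda>x. f x * g x)"
    using f g Holder_integrable[OF p f] by (auto simp: Lp_fun_def q_def)
  have ap: "(\<integral>x. \<bar>f x\<bar> powr p \<partial>M) = a powr p" and bq: "(\<integral>x. \<bar>g x\<bar> powr q \<partial>M) = b powr q"
    using p q by (auto simp: a_def b_def Lp_norm_powr)
  have zero: "(\<integral>x. \<bar>f x * g x\<bar> \<partial>M) = 0" if "AE x in M. f x * g x = 0"
    using that integral_cong_AE[of "\<lambda>x. \<bar>f x * g x\<bar>" M "\<lambda>_. 0"] by auto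
  consider "a = 0" | "b = 0" | "a > 0" "b > 0"
    using ab by linarith
  then show ?thesis
  proof cases
    case 1
    then have "AE x in M. f x = 0"
      using Lp_norm_eq_0_AE[OF _ f] p by (auto simp: a_def)
    then show ?thesis
      using ab by (subst zero) (auto simp: a_def b_def)
  next
    case 2
    then have "AE x in M. g x = 0"
      using Lp_norm_eq_0_AE[OF _ g] q by (auto simp: b_def)
    then show ?thesis
      using ab by (subst zero) (auto simp: a_def b_def)
  next
    case 3
    have bound: "\<bar>f x * g x\<bar> \<le> a * b * (\<bar>f x\<bar> powr p / (p * a powr p) + \<bar>g x\<bar> powr q / (q * b powr q))"
      for x
    proof -
      have "\<bar>f x\<bar> / a * (\<bar>g x\<bar> / b) \<le> (\<bar>f x\<bar> / a) powr p / p + (\<bar>g x\<bar> / b) powr q / q"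
        using p q 3 by (intro Youngs_inequality) auto
      also have "\<dots> = \<bar>f x\<bar> powr p / (p * a powr p) + \<bar>g x\<bar> powr q / (q * b powr q)"
        using 3 by (simp add: powr_divide mult.commute)
      finally have "a * b * (\<bar>f x\<bar> / a * (\<bar>g x\<bar> / b))
          \<le> a * b * (\<bar>f x\<bar> powr p / (p * a powr p) + \<bar>g x\<bar> powr q / (q * b powr q))"
        using 3 by (intro mult_left_mono) auto
      then show ?thesis
        using 3 by (simp add: abs_mult)
    qed
    have "(\<integral>x. \<bar>f x * g x\<bar> \<partial>M) \<le> (\<integral>x. a * b * (\<bar>f x\<bar> powr p / (p * a powr p) + \<bar>g x\<bar> powr q / (q * b powr q)) \<partial>M)"
      by (rule integral_mono) (use int bound in auto)
    also have "\<dots> = a * b * (1 / p + 1 / q)"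
      using int 3 p q by (simp add: ap bq)
    finally show ?thesis
      using q by (simp add: a_def b_def q_def)
  qed
qed

lemma Holder_inequality:
  assumes "1 < p" "f \<in> Lp_fun p M" "g \<in> Lp_fun (conj_exp p) M"
  shows "\<bar>\<integral>x. f x * g x \<partial>M\<bar> \<le> Lp_norm p M f * Lp_norm (conj_exp p) M g"
  using integral_abs_bound[of M "\<lambda>x. f x * g x"] Holder_inequality_abs[OF assms] by linarith

text \<open>Applying Hoelder to \<open>f\<close> and the indicator of \<open>[a,b]\<close> gives Minkowski's inequality for integrals.\<close>

lemma Lp_fun_integral_Icc:
  fixes W :: "real \<times> 'a \<Rightarrow> real"
  assumes M: "sigma_finite_measure M" and p: "1 < p" and ab: "a \<le> b" and C: "0 \<le> C"
    and W [measurable]: "W \<in> borel_measurable (borel \<Otimes>\<^sub>M M)"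
    and sec: "\<And>t. t \<in> {a..b} \<Longrightarrow> (\<lambda>x. W (t, x)) \<in> Lp_fun p M"
    and bd: "\<And>t. t \<in> {a..b} \<Longrightarrow> Lp_norm p M (\<lambda>x. W (t, x)) \<le> C"
  shows "AE x in M. integrable lborel (\<lambda>t. indicator {a..b} t * W (t, x))" (is ?A)
    and "(\<lambda>x. \<integral>t. indicator {a..b} t * W (t, x) \<partial>lborel) \<in> Lp_fun p M" (is ?B)
    and "Lp_norm p M (\<lambda>x. \<integral>t. indicator {a..b} t * W (t, x) \<partial>lborel) \<le> (b - a) * C" (is ?C)
proof -
  interpret M: sigma_finite_measure M by fact
  interpret pair_sigma_finite lborel M ..
  have [measurable]: "W \<in> borel_measurable (lborel \<Otimes>\<^sub>M M)"
    using W by (simp cong: measurable_cong_sets)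
  \<comment> \<open>Cutting \<open>W\<close> off outside \<open>{a..b}\<close> lets all time
    integrals run over \<open>lborel\<close>, so that Fubini's theorem applies to a plain product
    measure.\<close>
  define Z where "Z z = indicator {a..b} (fst z) * W z" for z
  have [measurable]: "Z \<in> borel_measurable (lborel \<Otimes>\<^sub>M M)"
    unfolding Z_def by measurable
  define w where "w x = (\<integral>t. Z (t, x) \<partial>lborel)" for x
  have wm [measurable]: "w \<in> borel_measurable M"
    unfolding w_def by measurable
  have powr_Z: "\<bar>Z (t, x)\<bar> powr p = indicator {a..b} t * \<bar>W (t, x)\<bar> powr p" for t x
    by (simp add: Z_def split: split_indicator)
  have Wi: "integrable M (\<lambda>x. \<bar>W (t, x)\<bar> powr p)" if "t \<in> {a..b}" for t
    using sec[OF that] by (simp add: Lp_fun_def)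
  have inner: "(\<integral>x. \<bar>Z (t, x)\<bar> powr p \<partial>M) \<le> indicator {a..b} t * C powr p" for t
  proof (cases "t \<in> {a..b}")
    case True
    have "(\<integral>x. \<bar>W (t, x)\<bar> powr p \<partial>M) = Lp_norm p M (\<lambda>x. W (t, x)) powr p"
      using p by (simp add: Lp_norm_powr)
    also have "\<dots> \<le> C powr p"
      using bd[OF True] p by (intro powr_mono2) auto
    finally show ?thesis
      using True by (simp add: powr_Z)
  qed (simp add: powr_Z)
  have ind: "integrable lborel (\<lambda>t. indicator {a..b} t * c :: real)" for c
    using ab by (intro integrable_mult_left) auto
  \<comment> \<open>At fixed time the integral over \<open>x\<close> is at most
    \<open>C powr p\<close>, and the time interval has finite length; this is the hypothesis of
    Fubini's theorem.\<close>
  have Zi: "integrable (lborel \<Otimes>\<^sub>M M) (\<lambda>z. \<bar>Z z\<bar> powr p)"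
  proof (rule Fubini_integrable)
    show "integrable lborel (\<lambda>t. \<integral>x. norm (\<bar>Z (t, x)\<bar> powr p) \<partial>M)"
      by (rule Bochner_Integration.integrable_bound[OF ind[of "C powr p"]])
        (use inner in auto)
    have "integrable M (\<lambda>x. \<bar>Z (t, x)\<bar> powr p)" for t
      unfolding powr_Z using Wi by (cases "t \<in> {a..b}") auto
    then show "AE t in lborel. integrable M (\<lambda>x. \<bar>Z (t, x)\<bar> powr p)"
      by simp
  qed simp
  then have Zi': "integrable (lborel \<Otimes>\<^sub>M M) (case_prod (\<lambda>t x. \<bar>Z (t, x)\<bar> powr p))"
    by (simp add: case_prod_unfold)
  \<comment> \<open>The indicator is the second factor for Hoelder's inequality in the time
    variable.\<close>
  have ip: "(\<lambda>t. indicator {a..b} t) \<in> Lp_fun (conj_exp p) lborel"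
  proof -
    have "\<bar>indicator {a..b} t\<bar> powr conj_exp p = (indicator {a..b} t :: real)" for t
      by (simp split: split_indicator)
    then show ?thesis
      using ab by (simp add: Lp_fun_def)
  qed
  have in_norm: "Lp_norm (conj_exp p) lborel (indicator {a..b}) = (b - a) powr (1 / conj_exp p)"
  proof -
    have "\<bar>indicator {a..b} t\<bar> powr conj_exp p = (indicator {a..b} t :: real)" for t
      by (simp split: split_indicator)
    then show ?thesis
      using ab by (simp add: Lp_norm_def)
  qed
  have Zind: "Z (t, x) * indicator {a..b} t = Z (t, x)" for t x
    by (simp add: Z_def split: split_indicator)
  have sliceLp: "AE x in M. (\<lambda>t. Z (t, x)) \<in> Lp_fun p lborel"
    using AE_integrable_snd[OF Zi'] AE_space by eventually_elim (simp add: Lp_fun_def)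
  have Ai: "AE x in M. integrable lborel (\<lambda>t. Z (t, x))"
    using sliceLp
  proof eventually_elim
    case (elim x)
    show ?case
      using Holder_integrable[OF p elim ip] by (simp add: Zind)
  qed
  then show ?A
    by (simp add: Z_def)
  \<comment> \<open>Hoelder in \<open>t\<close> for almost every fixed \<open>x\<close>. The norm of
    the indicator, raised to the power \<open>p\<close>, becomes
    \<open>(b - a) powr (p / conj_exp p)\<close>.\<close>
  have wbound: "AE x in M. \<bar>w x\<bar> powr p \<le> (b - a) powr (p - 1) * (\<integral>t. \<bar>Z (t, x)\<bar> powr p \<partial>lborel)"
    using sliceLp
  proof eventually_elim
    case (elim x)
    have "\<bar>w x\<bar> \<le> Lp_norm p lborel (\<lambda>t. Z (t, x)) * (b - a) powr (1 / conj_exp p)"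
      using Holder_inequality[OF p elim ip] by (simp add: Zind in_norm w_def)
    then have "\<bar>w x\<bar> powr p \<le> (Lp_norm p lborel (\<lambda>t. Z (t, x)) * (b - a) powr (1 / conj_exp p)) powr p"
      using p by (intro powr_mono2) auto
    also have "\<dots> = (\<integral>t. \<bar>Z (t, x)\<bar> powr p \<partial>lborel) * (b - a) powr (p / conj_exp p)"
      using p ab by (simp add: powr_mult Lp_norm_powr powr_powr)
    also have "p / conj_exp p = p - 1"
      using p by (simp add: conj_exp_def field_simps)
    finally show ?case
      by (simp add: mult.commute)
  qed
  have snd_i: "integrable M (\<lambda>x. (b - a) powr (p - 1) * (\<integral>t. \<bar>Z (t, x)\<bar> powr p \<partial>lborel))"
    by (intro integrable_mult_right integrable_snd[OF Zi'])
  have wi: "integrable M (\<lambda>x. \<bar>w x\<bar> powr p)"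
    by (rule Bochner_Integration.integrable_bound[OF snd_i])
      (use wbound ab in \<open>auto elim!: eventually_mono\<close>)
  then show ?B
    using wm by (simp add: Lp_fun_def w_def[abs_def] Z_def)
  have "(\<integral>x. \<bar>w x\<bar> powr p \<partial>M) \<le> (\<integral>x. (b - a) powr (p - 1) * (\<integral>t. \<bar>Z (t, x)\<bar> powr p \<partial>lborel) \<partial>M)"
    by (rule integral_mono_AE[OF wi snd_i wbound])
  \<comment> \<open>Exchanging the integrals returns to slices at fixed time, which
    \<open>inner\<close> controls; integrating this bound in time yields the missing factor
    \<open>b - a\<close>.\<close>
  also have "\<dots> = (b - a) powr (p - 1) * (\<integral>t. (\<integral>x. \<bar>Z (t, x)\<bar> powr p \<partial>M) \<partial>lborel)"
    using Fubini_integral[OF Zi'] by simp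
  also have "\<dots> \<le> (b - a) powr (p - 1) * (\<integral>t. indicator {a..b} t * C powr p \<partial>lborel)"
    by (intro mult_left_mono integral_mono inner integrable_fst[OF Zi'] ind) simp
  also have "\<dots> = (b - a) powr (p - 1) * ((b - a) * C powr p)"
    using ab by simp
  also have "\<dots> = ((b - a) * C) powr p"
  proof (cases "a = b")
    case False
    then have "(b - a) powr (p - 1) * (b - a) = (b - a) powr p"
      using ab by (metis diff_add_cancel diff_gt_0_iff_gt less_eq_real_def powr_add powr_one)
    then have "(b - a) powr (p - 1) * ((b - a) * C powr p) = (b - a) powr p * C powr p"
      by (metis mult.assoc)
    then show ?thesis
      using ab C by (simp add: powr_mult)
  qed (use p in simp)
  finally show ?C
    using p ab C by (intro Lp_norm_leI) (auto simp: w_def Z_def)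
qed

section \<open>Metric and pairing on classes\<close>

lemma Lp_dist_eq_norm: "Lp_dist p M X Y = Lp_norm p M (\<lambda>x. rep X x - rep Y x)"
  by (simp add: Lp_dist_def Lp_norm_def)

lemma Lp_dist_ae_class_norm:
  assumes "f \<in> borel_measurable M" "g \<in> borel_measurable M"
  shows "Lp_dist p M (ae_class M f) (ae_class M g) = Lp_norm p M (\<lambda>x. f x - g x)"
  using Lp_dist_ae_class[OF assms, of p] by (simp add: Lp_norm_def)

lemma rep_measurable: "X \<in> Lp p M \<Longrightarrow> rep X \<in> borel_measurable M"
  using rep_Lp(1) Lp_fun_measurable by blast

lemma Lp_add_in_Lp: "1 \<le> p \<Longrightarrow> X \<in> Lp p M \<Longrightarrow> Y \<in> Lp p M \<Longrightarrow> Lp_add M X Y \<in> Lp p M"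
  and Lp_scale_in_Lp: "1 \<le> p \<Longrightarrow> X \<in> Lp p M \<Longrightarrow> Lp_scale M c X \<in> Lp p M"
  and Lp_zero_in_Lp: "1 \<le> p \<Longrightarrow> Lp_zero M \<in> Lp p M"
  using Lp_subspace_Lp[of p M] by (auto simp: Lp_subspace_def)

lemma Lp_diff_in_Lp: "1 \<le> p \<Longrightarrow> X \<in> Lp p M \<Longrightarrow> Y \<in> Lp p M \<Longrightarrow> Lp_diff M X Y \<in> Lp p M"
  unfolding Lp_diff_def by (intro ae_class_in_Lp Lp_fun_diff rep_Lp)

lemma Lp_dist_nonneg [simp]: "0 \<le> Lp_dist p M X Y"
  by (simp add: Lp_dist_def)

lemma Lp_dist_commute: "Lp_dist p M X Y = Lp_dist p M Y X"
  by (simp add: Lp_dist_def abs_minus_commute)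

lemma Lp_dist_triangle:
  "1 \<le> p \<Longrightarrow> X \<in> Lp p M \<Longrightarrow> Y \<in> Lp p M \<Longrightarrow> Z \<in> Lp p M \<Longrightarrow>
    Lp_dist p M X Z \<le> Lp_dist p M X Y + Lp_dist p M Y Z"
  using Metric_space.triangle[OF Metric_space_Lp] by blast

lemma Lp_dist_eq_0_iff:
  "1 \<le> p \<Longrightarrow> X \<in> Lp p M \<Longrightarrow> Y \<in> Lp p M \<Longrightarrow> Lp_dist p M X Y = 0 \<longleftrightarrow> X = Y"
  using Metric_space.zero[OF Metric_space_Lp] by blast

lemma Lp_dist_add_le:
  assumes "1 \<le> p" "X \<in> Lp p M" "Y \<in> Lp p M" "X' \<in> Lp p M" "Y' \<in> Lp p M"
  shows "Lp_dist p M (Lp_add M X Y) (Lp_add M X' Y') \<le> Lp_dist p M X X' + Lp_dist p M Y Y'"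
proof -
  note [measurable] = assms(2-5)[THEN rep_measurable]
  have "Lp_dist p M (Lp_add M X Y) (Lp_add M X' Y') =
      Lp_norm p M (\<lambda>x. (rep X x - rep X' x) + (rep Y x - rep Y' x))"
    unfolding Lp_add_def by (subst Lp_dist_ae_class_norm) (auto simp: algebra_simps)
  also have "\<dots> \<le> Lp_dist p M X X' + Lp_dist p M Y Y'"
    using Minkowski_inequality[OF assms(1), of "\<lambda>x. rep X x - rep X' x" M "\<lambda>x. rep Y x - rep Y' x"] assms
    by (auto simp: Lp_dist_def Lp_norm_def intro!: Lp_fun_diff rep_Lp)
  finally show ?thesis .
qed

lemma Lp_dist_scale:
  assumes "1 \<le> p" "X \<in> Lp p M" "Y \<in> Lp p M"
  shows "Lp_dist p M (Lp_scale M c X) (Lp_scale M c Y) = \<bar>c\<bar> * Lp_dist p M X Y"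
proof -
  note [measurable] = assms(2,3)[THEN rep_measurable]
  have "Lp_dist p M (Lp_scale M c X) (Lp_scale M c Y) = Lp_norm p M (\<lambda>x. c * (rep X x - rep Y x))"
    unfolding Lp_scale_def by (subst Lp_dist_ae_class_norm) (auto simp: algebra_simps)
  also have "\<dots> = \<bar>c\<bar> * Lp_dist p M X Y"
    using assms(1) by (simp add: Lp_dist_def Lp_norm_def abs_mult powr_mult powr_powr)
  finally show ?thesis .
qed

lemma Lp_scale_one: "X \<in> Lp p M \<Longrightarrow> Lp_scale M 1 X = X"
  unfolding Lp_scale_def by (simp add: rep_Lp(2))

lemma Lp_scale_scale:
  assumes "X \<in> Lp p M"
  shows "Lp_scale M c (Lp_scale M d X) = Lp_scale M (c * d) X"
proof -
  note [measurable] = assms[THEN rep_measurable]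
  show ?thesis
    unfolding Lp_scale_def[of M d X] by (subst Lp_scale_ae_class) (auto simp: Lp_scale_def mult.assoc)
qed

text \<open>Lipschitz continuity of the pairing in its first argument, by Hoelder; it turns
  continuity of a curve into continuity of a real function.\<close>

lemma Lp_pairing_diff_le:
  assumes p: "1 < p" and X: "X \<in> Lp p M" "X' \<in> Lp p M" and Y: "Y \<in> Lp (conj_exp p) M"
  shows "\<bar>Lp_pairing M X Y - Lp_pairing M X' Y\<bar> \<le> Lp_dist p M X X' * Lp_norm (conj_exp p) M (rep Y)"
proof -
  note r = X[THEN rep_Lp(1)] Y[THEN rep_Lp(1)]
  have "Lp_pairing M X Y - Lp_pairing M X' Y = (\<integral>x. (rep X x - rep X' x) * rep Y x \<partial>M)"
    unfolding Lp_pairing_def left_diff_distrib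
    by (rule Bochner_Integration.integral_diff[symmetric]) (auto intro: Holder_integrable[OF p] r)
  then show ?thesis
    using Holder_inequality[OF p Lp_fun_diff[OF _ r(1,2)] r(3)] p by (simp add: Lp_dist_eq_norm)
qed

lemma Lp_pairing_diff:
  assumes p: "1 < p" and X: "X \<in> Lp p M" "X' \<in> Lp p M" and Y: "Y \<in> Lp (conj_exp p) M"
  shows "Lp_pairing M (Lp_diff M X X') Y = Lp_pairing M X Y - Lp_pairing M X' Y"
proof -
  note r = X[THEN rep_Lp(1)] Y[THEN rep_Lp(1)]
  note [measurable] = r[THEN Lp_fun_measurable]
  have "Lp_pairing M (Lp_diff M X X') Y = Lp_pairing M (Lp_diff M X X') (ae_class M (rep Y))"
    using rep_Lp(2)[OF Y] by simp
  also have "\<dots> = (\<integral>x. (rep X x - rep X' x) * rep Y x \<partial>M)"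
    unfolding Lp_diff_def by (rule Lp_pairing_ae_class) auto
  also have "\<dots> = Lp_pairing M X Y - Lp_pairing M X' Y"
    unfolding Lp_pairing_def left_diff_distrib
    by (rule Bochner_Integration.integral_diff) (auto intro: Holder_integrable[OF p] r)
  finally show ?thesis .
qed

text \<open>Serves to rewrite the integral over \<open>[h, t + h]\<close> minus that over
  \<open>[0, t]\<close> as the integral over \<open>[t, t + h]\<close> minus that over
  \<open>[0, h]\<close>: in both cases the two ways of splitting \<open>[0, t + h]\<close> are
  compared.\<close>

lemma Lp_diff_eq_if_add_eq:
  assumes "1 \<le> p" "X \<in> Lp p M" "Y \<in> Lp p M" "Z \<in> Lp p M" "W \<in> Lp p M"
    and eq: "Lp_add M X Y = Lp_add M Z W"
  shows "Lp_diff M W X = Lp_diff M Y Z"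
proof -
  note [measurable] = assms(2-5)[THEN rep_measurable]
  have "AE x in M. rep X x + rep Y x = rep Z x + rep W x"
    using eq unfolding Lp_add_def by (subst (asm) ae_class_eq_iff) auto
  then show ?thesis
    unfolding Lp_diff_def by (subst ae_class_eq_iff) (auto elim!: eventually_mono)
qed

lemma Lp_dist_diff_le:
  assumes "1 \<le> p" "X \<in> Lp p M" "Y \<in> Lp p M" "X' \<in> Lp p M" "Y' \<in> Lp p M"
  shows "Lp_dist p M (Lp_diff M X Y) (Lp_diff M X' Y') \<le> Lp_dist p M X X' + Lp_dist p M Y Y'"
proof -
  note [measurable] = assms(2-5)[THEN rep_measurable]
  have "Lp_dist p M (Lp_diff M X Y) (Lp_diff M X' Y') =
      Lp_norm p M (\<lambda>x. (rep X x - rep X' x) + (rep Y' x - rep Y x))"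
    unfolding Lp_diff_def by (subst Lp_dist_ae_class_norm) (auto simp: algebra_simps)
  also have "\<dots> \<le> Lp_dist p M X X' + Lp_dist p M Y' Y"
    using Minkowski_inequality[OF assms(1), of "\<lambda>x. rep X x - rep X' x" M "\<lambda>x. rep Y' x - rep Y x"] assms
    by (auto simp: Lp_dist_def Lp_norm_def intro!: Lp_fun_diff rep_Lp)
  finally show ?thesis
    by (simp add: Lp_dist_commute)
qed

lemma Lp_scale_diff:
  assumes "X \<in> Lp p M" "Y \<in> Lp p M"
  shows "Lp_scale M c (Lp_diff M X Y) = Lp_diff M (Lp_scale M c X) (Lp_scale M c Y)"
proof -
  note [measurable] = assms[THEN rep_measurable]
  show ?thesis
    unfolding Lp_diff_def[of M X] Lp_scale_def[of M c X] Lp_scale_def[of M c Y]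
    by (subst Lp_scale_ae_class, measurable, subst Lp_diff_ae_class) (auto simp: algebra_simps)
qed

lemma Lp_eqI_dist:
  assumes "1 \<le> p" "X \<in> Lp p M" "Y \<in> Lp p M" and le: "\<And>e. 0 < e \<Longrightarrow> Lp_dist p M X Y \<le> e"
  shows "X = Y"
proof -
  have "Lp_dist p M X Y \<le> 0"
    by (rule field_le_epsilon) (simp add: le)
  then have "Lp_dist p M X Y = 0"
    by (simp add: order_antisym)
  then show ?thesis
    using Lp_dist_eq_0_iff[OF assms(1-3)] by simp
qed

section \<open>Continuous curves in \<open>L\<^sup>p(M)\<close> and their integrals\<close>

text \<open>Isolates what is needed of an orbit before the semigroup law comes in. Nothing is
  assumed about \<open>u\<close> at negative times.\<close>

locale Lp_curve =
  fixes M :: "'a measure" and p :: real and u :: "real \<Rightarrow> ('a \<Rightarrow> real) set"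
  assumes sigma_finite_M: "sigma_finite_measure M"
    and p: "1 < p"
    and cont: "continuous_map (top_of_set {0..}) (Lp_topology p M) u"
begin

lemma p1: "1 \<le> p"
  using p by simp

lemma in_Lp: "0 \<le> t \<Longrightarrow> u t \<in> Lp p M"
  using cont p1 by (auto simp: continuous_map_def)

lemma continuous_at_point:
  assumes t: "0 \<le> t" and e: "0 < e"
  obtains d where "0 < d" "\<And>s. 0 \<le> s \<Longrightarrow> \<bar>s - t\<bar> < d \<Longrightarrow> Lp_dist p M (u s) (u t) < e"
proof -
  interpret Metric_space "Lp p M" "Lp_dist p M"
    by (rule Metric_space_Lp[OF p1])
  have "\<forall>t\<in>{0..}. \<forall>e>0. \<exists>U. openin (top_of_set {0..}) U \<and> t \<in> U \<and> (\<forall>y\<in>U. u y \<in> mball (u t) e)"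
    using cont unfolding Lp_topology_def continuous_map_to_metric by simp
  then obtain U where U: "openin (top_of_set {0..}) U" "t \<in> U" "\<forall>y\<in>U. u y \<in> mball (u t) e"
    using t e by (meson atLeast_iff)
  then obtain d where d: "d > 0" "\<forall>s\<in>{0..}. dist s t < d \<longrightarrow> s \<in> U"
    unfolding openin_euclidean_subtopology_iff by blast
  show ?thesis
  proof (rule that[OF d(1)])
    fix s assume "0 \<le> s" "\<bar>s - t\<bar> < d"
    then have "u s \<in> mball (u t) e"
      using d(2) U(3) by (metis atLeast_iff dist_real_def)
    then show "Lp_dist p M (u s) (u t) < e"
      by (simp add: Lp_dist_commute)
  qed
qed

text \<open>The Heine-Cantor theorem is applied to the real function \<open>?G\<close> on a compact
  square. Comparing \<open>?G\<close> at \<open>(s, t)\<close> with its value 0 at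
  \<open>(t, t)\<close> gives the estimate.\<close>

lemma uniformly_continuous:
  assumes e: "0 < e"
  obtains d where "0 < d"
    "\<And>s t. s \<in> {0..T} \<Longrightarrow> t \<in> {0..T} \<Longrightarrow> \<bar>s - t\<bar> < d \<Longrightarrow> Lp_dist p M (u s) (u t) < e"
proof -
  let ?G = "\<lambda>z. Lp_dist p M (u (fst z)) (u (snd z))" and ?S = "{0..T} \<times> {0..T}"
  have "continuous_on ?S ?G"
  proof (rule continuous_on_iff[THEN iffD2], safe)
    fix s t e :: real assume st: "s \<in> {0..T}" "t \<in> {0..T}" and e: "0 < e"
    obtain d1 where d1: "0 < d1" "\<And>r. 0 \<le> r \<Longrightarrow> \<bar>r - s\<bar> < d1 \<Longrightarrow> Lp_dist p M (u r) (u s) < e / 2"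
      using continuous_at_point[of s "e / 2"] st e by auto
    obtain d2 where d2: "0 < d2" "\<And>r. 0 \<le> r \<Longrightarrow> \<bar>r - t\<bar> < d2 \<Longrightarrow> Lp_dist p M (u r) (u t) < e / 2"
      using continuous_at_point[of t "e / 2"] st e by auto
    show "\<exists>d>0. \<forall>z\<in>?S. dist z (s, t) < d \<longrightarrow> dist (?G z) (?G (s, t)) < e"
    proof (intro exI[of _ "min d1 d2"] conjI ballI impI)
      fix z assume z: "z \<in> ?S" "dist z (s, t) < min d1 d2"
      obtain s' t' where [simp]: "z = (s', t')"
        by (cases z)
      have "\<bar>s' - s\<bar> < d1" "\<bar>t' - t\<bar> < d2"
        using z dist_fst_le[of z "(s, t)"] dist_snd_le[of z "(s, t)"] by (auto simp: dist_real_def)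
      then have "Lp_dist p M (u s') (u s) < e / 2" "Lp_dist p M (u t') (u t) < e / 2"
        using z d1(2) d2(2) by auto
      moreover have L: "u s \<in> Lp p M" "u t \<in> Lp p M" "u s' \<in> Lp p M" "u t' \<in> Lp p M"
        using st z by (auto intro: in_Lp)
      moreover have "\<bar>?G z - ?G (s, t)\<bar> \<le> Lp_dist p M (u s') (u s) + Lp_dist p M (u t') (u t)"
        using Lp_dist_triangle[OF p1 L(3) L(1) L(4)] Lp_dist_triangle[OF p1 L(1) L(2) L(4)]
          Lp_dist_triangle[OF p1 L(1) L(3) L(2)] Lp_dist_triangle[OF p1 L(3) L(4) L(2)]
        by (simp add: Lp_dist_commute)
      ultimately show "dist (?G z) (?G (s, t)) < e"
        by (simp add: dist_real_def)
    qed (use d1 d2 in auto)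
  qed
  then have "uniformly_continuous_on ?S ?G"
    by (intro compact_uniformly_continuous compact_Times) auto
  then obtain d where d: "d > 0" "\<And>x y. x \<in> ?S \<Longrightarrow> y \<in> ?S \<Longrightarrow> dist y x < d \<Longrightarrow> dist (?G y) (?G x) < e"
    using e unfolding uniformly_continuous_on_def by blast
  show ?thesis
  proof (rule that[OF d(1)])
    fix s t assume st: "s \<in> {0..T}" "t \<in> {0..T}" "\<bar>s - t\<bar> < d"
    then have "Lp_dist p M (u t) (u t) = 0"
      using Lp_dist_eq_0_iff[OF p1, of "u t" M "u t"] by (simp add: in_Lp)
    then show "Lp_dist p M (u s) (u t) < e"
      using d(2)[of "(t, t)" "(s, t)"] st by (simp add: dist_real_def dist_prod_def)
  qed
qed

text \<open>The norm is the distance to the zero class, hence a continuous real function on a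
  compact interval.\<close>

lemma norm_bounded:
  obtains C where "0 \<le> C" "\<And>t. t \<in> {0..T} \<Longrightarrow> Lp_norm p M (rep (u t)) \<le> C"
proof -
  let ?z = "Lp_zero M"
  have norm: "Lp_norm p M (rep (u t)) = Lp_dist p M (u t) ?z" if "0 \<le> t" for t
  proof -
    note [measurable] = in_Lp[OF that, THEN rep_measurable]
    have "Lp_dist p M (ae_class M (rep (u t))) ?z = Lp_norm p M (rep (u t))"
      unfolding Lp_zero_def by (subst Lp_dist_ae_class_norm) auto
    then show ?thesis
      using rep_Lp(2)[OF in_Lp[OF that]] by simp
  qed
  have "continuous_on {0..T} (\<lambda>t. Lp_dist p M (u t) ?z)"
  proof (rule continuous_on_iff[THEN iffD2], safe)
    fix t e :: real assume t: "t \<in> {0..T}" and e: "0 < e"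
    obtain d where d: "0 < d" "\<And>r. 0 \<le> r \<Longrightarrow> \<bar>r - t\<bar> < d \<Longrightarrow> Lp_dist p M (u r) (u t) < e"
      using continuous_at_point[of t e] t e by auto
    have "dist (Lp_dist p M (u r) ?z) (Lp_dist p M (u t) ?z) < e" if "r \<in> {0..T}" "dist r t < d" for r
    proof -
      have L: "u r \<in> Lp p M" "u t \<in> Lp p M" "?z \<in> Lp p M"
        using that t Lp_zero_in_Lp[OF p1] by (auto intro: in_Lp)
      then show ?thesis
        using d(2)[of r] that Lp_dist_triangle[OF p1 L(1,2,3)] Lp_dist_triangle[OF p1 L(2,1,3)]
        by (simp add: dist_real_def Lp_dist_commute)
    qed
    then show "\<exists>d>0. \<forall>r\<in>{0..T}. dist r t < d \<longrightarrow>
        dist (Lp_dist p M (u r) ?z) (Lp_dist p M (u t) ?z) < e"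
      using d(1) by blast
  qed
  then have "bounded ((\<lambda>t. Lp_dist p M (u t) ?z) ` {0..T})"
    by (intro compact_imp_bounded compact_continuous_image) auto
  then obtain B where "\<And>t. t \<in> {0..T} \<Longrightarrow> \<bar>Lp_dist p M (u t) ?z\<bar> \<le> B"
    by (force simp: bounded_iff)
  \<comment> \<open>For negative \<open>T\<close> the interval is empty and \<open>B\<close> can be
    any number; the absolute value keeps the bound nonnegative.\<close>
  then show ?thesis
    by (intro that[of "\<bar>B\<bar>"]) (force simp: norm)+
qed

lemma pairing_continuous:
  assumes Y: "Y \<in> Lp (conj_exp p) M"
  shows "continuous_on {0..} (\<lambda>t. Lp_pairing M (u t) Y)"
proof (rule continuous_on_iff[THEN iffD2], safe)
  fix t e :: real assume t: "0 \<le> t" and e: "0 < e"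
  \<comment> \<open>The summand 1 allows division by \<open>N\<close> even if \<open>Y\<close> has
    norm 0.\<close>
  define N where "N = Lp_norm (conj_exp p) M (rep Y) + 1"
  have N: "0 < N"
    unfolding N_def by (simp add: add_nonneg_pos)
  obtain d where d: "0 < d" "\<And>r. 0 \<le> r \<Longrightarrow> \<bar>r - t\<bar> < d \<Longrightarrow> Lp_dist p M (u r) (u t) < e / N"
    using continuous_at_point[of t "e / N"] t e N by auto
  have "dist (Lp_pairing M (u r) Y) (Lp_pairing M (u t) Y) < e" if "0 \<le> r" "dist r t < d" for r
  proof -
    have "\<bar>Lp_pairing M (u r) Y - Lp_pairing M (u t) Y\<bar>
        \<le> Lp_dist p M (u r) (u t) * Lp_norm (conj_exp p) M (rep Y)"
      using that t by (intro Lp_pairing_diff_le p in_Lp Y)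
    also have "\<dots> \<le> Lp_dist p M (u r) (u t) * N"
      by (intro mult_left_mono) (auto simp: N_def)
    also have "\<dots> < e"
      using d(2)[of r] that N by (simp add: dist_real_def field_simps)
    finally show ?thesis
      by (simp add: dist_real_def)
  qed
  then show "\<exists>d>0. \<forall>r\<in>{0..}. dist r t < d \<longrightarrow> dist (Lp_pairing M (u r) Y) (Lp_pairing M (u t) Y) < e"
    using d(1) by auto
qed

section \<open>Jointly measurable versions\<close>

text \<open>Step functions in time are jointly measurable. If their mesh shrinks so fast that the
  errors are summable, they converge almost everywhere at every fixed \<open>t\<close>, not merely
  at almost every \<open>t\<close>.\<close>

lemma joint_version_Icc:
  obtains U where "U \<in> borel_measurable (borel \<Otimes>\<^sub>M M)"
    "\<And>t. t \<in> {0..T} \<Longrightarrow> AE x in M. U (t, x) = rep (u t) x"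
proof -
  \<comment> \<open>The exponent \<open>1 / p\<close> is chosen so that the \<open>p\<close>-th
    power of the distance stays below \<open>(1/2) ^ k\<close>.\<close>
  have "\<exists>d>0. \<forall>s\<in>{0..T}. \<forall>t\<in>{0..T}. \<bar>s - t\<bar> < d \<longrightarrow> Lp_dist p M (u s) (u t) < ((1/2) ^ k) powr (1 / p)"
    for k :: nat
    by (rule uniformly_continuous[of "((1/2) ^ k) powr (1 / p)" T]) auto
  then obtain d where d: "\<And>k :: nat. 0 < d k"
    "\<And>k s t. s \<in> {0..T} \<Longrightarrow> t \<in> {0..T} \<Longrightarrow> \<bar>s - t\<bar> < d k \<Longrightarrow>
        Lp_dist p M (u s) (u t) < ((1/2) ^ k) powr (1 / p)"
    by metis
  define h where "h k = d k / 2" for k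
  have h: "0 < h k" for k
    using d(1) by (simp add: h_def)
  \<comment> \<open>\<open>V k\<close> samples the curve at the left end of the grid cell of width
    \<open>h k\<close>. The maximum with 0 keeps the sampling time nonnegative, since
    \<open>V k\<close> has to be measurable on all of the product, negative times included.\<close>
  define V where "V k z = rep (u (max 0 (h k * of_int \<lfloor>fst z / h k\<rfloor>))) (snd z)" for k and z :: "real \<times> 'a"
  \<comment> \<open>The floor takes countably many values, and once it is fixed the function depends
    on \<open>x\<close> alone.\<close>
  have Vm [measurable]: "V k \<in> borel_measurable (borel \<Otimes>\<^sub>M M)" for k
    unfolding V_def
  proof (rule measurable_compose_countable[of "\<lambda>i z. rep (u (max 0 (h k * of_int i))) (snd z)" _ _
        "\<lambda>z. \<lfloor>fst z / h k\<rfloor>"])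
    fix i :: int
    note [measurable] = in_Lp[of "max 0 (h k * of_int i)", THEN rep_measurable, simplified]
    show "(\<lambda>z. rep (u (max 0 (h k * of_int i))) (snd z)) \<in> borel_measurable (borel \<Otimes>\<^sub>M M)"
      by measurable
  qed measurable
  \<comment> \<open>Where the sequence diverges, \<open>lim\<close> has an unspecified value;
    \<open>U\<close> is measurable all the same.\<close>
  define U where "U z = lim (\<lambda>k. V k z)" for z
  show ?thesis
  proof (rule that[of U])
    show "U \<in> borel_measurable (borel \<Otimes>\<^sub>M M)"
      unfolding U_def by measurable
    fix t assume t: "t \<in> {0..T}"
    define D where "D k x = \<bar>V k (t, x) - rep (u t) x\<bar> powr p" for k x
    note [measurable] = in_Lp[of t, THEN rep_measurable]
    have DM: "integrable M (D k) \<and> (\<integral>x. D k x \<partial>M) \<le> (1/2) ^ k" for k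
    proof -
      define s where "s = h k * of_int \<lfloor>t / h k\<rfloor>"
      have s: "s \<le> t" "t < s + h k" "0 \<le> s"
        using mult_left_mono[OF of_int_floor_le[of "t / h k"], of "h k"]
          mult_strict_left_mono[OF real_of_int_floor_add_one_gt[of "t / h k"], of "h k"] h[of k] t
        by (auto simp: s_def algebra_simps)
      then have "Lp_dist p M (u s) (u t) \<le> ((1/2) ^ k) powr (1 / p)"
        using t h[of k] by (intro less_imp_le d(2)) (auto simp: h_def)
      then have "Lp_dist p M (u s) (u t) powr p \<le> (((1/2) ^ k) powr (1 / p)) powr p"
        using p by (intro powr_mono2) auto
      moreover have "V k (t, x) = rep (u s) x" for x
        using s(3) by (simp add: V_def s_def)
      moreover have "(\<lambda>x. rep (u s) x - rep (u t) x) \<in> Lp_fun p M"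
        using s t by (intro Lp_fun_diff rep_Lp in_Lp p1) auto
      ultimately show ?thesis
        using p by (simp add: D_def[abs_def] Lp_dist_eq_norm Lp_norm_powr Lp_fun_def powr_powr)
    qed
    have [measurable]: "D k \<in> borel_measurable M" for k
      using DM by (blast intro: borel_measurable_integrable)
    have "(\<integral>\<^sup>+x. (\<Sum>k. ennreal (D k x)) \<partial>M) = (\<Sum>k. \<integral>\<^sup>+x. ennreal (D k x) \<partial>M)"
      by (intro nn_integral_suminf) measurable
    also have "\<dots> \<le> (\<Sum>k. ennreal ((1/2) ^ k))"
    proof (rule suminf_le)
      fix k
      have "(\<integral>\<^sup>+x. ennreal (D k x) \<partial>M) = ennreal (\<integral>x. D k x \<partial>M)"
        using DM by (intro nn_integral_eq_integral) (blast, simp add: D_def)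
      then show "(\<integral>\<^sup>+x. ennreal (D k x) \<partial>M) \<le> ennreal ((1/2) ^ k)"
        using DM by (metis ennreal_leI)
    qed simp_all
    also have "\<dots> = ennreal (\<Sum>k. (1/2) ^ k)"
      by (rule suminf_ennreal2) (simp_all add: summable_geometric)
    finally have "(\<integral>\<^sup>+x. (\<Sum>k. ennreal (D k x)) \<partial>M) \<noteq> \<infinity>"
      by (auto simp: top_unique)
    \<comment> \<open>The series of errors has finite integral, hence converges at almost every
      \<open>x\<close>, and its terms tend to 0 there.\<close>
    then have "AE x in M. (\<Sum>k. ennreal (D k x)) \<noteq> \<infinity>"
      by (intro nn_integral_noteq_infinite) measurable
    then show "AE x in M. U (t, x) = rep (u t) x"
    proof eventually_elim
      case (elim x)
      then have "summable (\<lambda>k. D k x)"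
        by (intro summable_suminf_not_top) (auto simp: D_def)
      then have "(\<lambda>k. D k x) \<longlonglongrightarrow> 0"
        by (rule summable_LIMSEQ_zero)
      then have "(\<lambda>k. D k x powr (1 / p)) \<longlonglongrightarrow> 0"
        using p by (intro tendsto_zero_powrI[of _ _ _ "1 / p"]) (auto simp: D_def)
      then have "(\<lambda>k. \<bar>V k (t, x) - rep (u t) x\<bar>) \<longlonglongrightarrow> 0"
        using p by (simp add: D_def powr_powr)
      then have "(\<lambda>k. V k (t, x)) \<longlonglongrightarrow> rep (u t) x"
        using LIM_zero_iff tendsto_rabs_zero_iff by blast
      then show "U (t, x) = rep (u t) x"
        by (simp add: U_def limI)
    qed
  qed
qed

text \<open>The versions on \<open>[0, n]\<close> are glued by using number
  \<open>\<lceil>t\<rceil>\<close> at time \<open>t\<close>. No compatibility between them is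
  required, and an integer-valued measurable index preserves measurability.\<close>

lemma joint_version:
  obtains U where "U \<in> borel_measurable (borel \<Otimes>\<^sub>M M)"
    "\<And>t. 0 \<le> t \<Longrightarrow> AE x in M. U (t, x) = rep (u t) x"
proof -
  have "\<exists>U \<in> borel_measurable (borel \<Otimes>\<^sub>M M). \<forall>t\<in>{0..of_int n}. AE x in M. U (t, x) = rep (u t) x"
    for n :: int
    by (rule joint_version_Icc[of "of_int n"]) blast
  then obtain U where U: "\<And>n. U n \<in> borel_measurable (borel \<Otimes>\<^sub>M M)"
    "\<And>n t. t \<in> {0..of_int n} \<Longrightarrow> AE x in M. U n (t, x) = rep (u t) x"
    by metis
  show ?thesis
  proof
    show "(\<lambda>z. U \<lceil>fst z\<rceil> z) \<in> borel_measurable (borel \<Otimes>\<^sub>M M)"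
      by (rule measurable_compose_countable[where g = "\<lambda>z. \<lceil>fst z\<rceil>" and f = U]) (use U(1) in auto)
    show "AE x in M. U \<lceil>fst (t, x)\<rceil> (t, x) = rep (u t) x" if "0 \<le> t" for t
      using U(2)[of t "\<lceil>t\<rceil>"] that by simp
  qed
qed

end

section \<open>Finite sums of classes and integrals of curves\<close>

text \<open>Addition of classes depends on the measure \<open>M\<close>, so finite sums are built by
  recursion. They represent Riemann sums of curves.\<close>

primrec Lp_sum :: "'a measure \<Rightarrow> (nat \<Rightarrow> ('a \<Rightarrow> real) set) \<Rightarrow> nat \<Rightarrow> ('a \<Rightarrow> real) set" where
  "Lp_sum M v 0 = Lp_zero M"
| "Lp_sum M v (Suc n) = Lp_add M (Lp_sum M v n) (v n)"

lemma Lp_sum_in_Lp: "1 \<le> p \<Longrightarrow> (\<And>k. v k \<in> Lp p M) \<Longrightarrow> Lp_sum M v n \<in> Lp p M"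
  by (induction n) (auto intro: Lp_zero_in_Lp Lp_add_in_Lp)

lemma Lp_linear_on_zero:
  assumes "1 \<le> p" "Lp_linear_on p M (Lp p M) A"
  shows "A (Lp_zero M) = Lp_zero M"
proof -
  have z: "Lp_zero M \<in> Lp p M"
    by (rule Lp_zero_in_Lp[OF assms(1)])
  have s: "Lp_scale M 0 X = Lp_zero M" for X
    by (simp add: Lp_scale_def Lp_zero_def)
  have "A (Lp_scale M 0 (Lp_zero M)) = Lp_scale M 0 (A (Lp_zero M))"
    using assms(2) z by (simp add: Lp_linear_on_def)
  then show ?thesis
    by (simp add: s)
qed

lemma Lp_linear_on_sum:
  assumes "1 \<le> p" "Lp_linear_on p M (Lp p M) A" "\<And>k. v k \<in> Lp p M"
  shows "A (Lp_sum M v n) = Lp_sum M (\<lambda>k. A (v k)) n"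
  using Lp_linear_on_zero[OF assms(1,2)] assms(2,3) Lp_sum_in_Lp[OF assms(1,3)]
  by (induction n) (simp_all add: Lp_linear_on_def)

text \<open>The exceptional null set may vary with \<open>t\<close>; joint measurability is what
  allows these null sets to be handled by Fubini's theorem.\<close>

locale Lp_curve_version = Lp_curve +
  fixes U
  assumes U_measurable: "U \<in> borel_measurable (borel \<Otimes>\<^sub>M M)"
    and U_version: "0 \<le> t \<Longrightarrow> AE x in M. U (t, x) = rep (u t) x"
begin

text \<open>Plays the role of the Bochner integral of the curve over \<open>[a, b]\<close>. For
  \<open>0 \<le> a\<close> and \<open>a \<le> b\<close> the default value 0 of the inner integral
  occurs at most on a null set of points \<open>x\<close>.\<close>

definition curve_integral :: "real \<Rightarrow> real \<Rightarrow> ('a \<Rightarrow> real) set" where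
  "curve_integral a b = ae_class M (\<lambda>x. \<integral>t. indicator {a..b} t * U (t, x) \<partial>lborel)"

lemma U_measurable_lborel: "U \<in> borel_measurable (lborel \<Otimes>\<^sub>M M)"
  using U_measurable by (simp cong: measurable_cong_sets)

lemma U_section_measurable [measurable]: "(\<lambda>x. U (t, x)) \<in> borel_measurable M"
  by (rule measurable_compose[OF _ U_measurable]) measurable

lemma U_section_Lp_fun: "0 \<le> t \<Longrightarrow> (\<lambda>x. U (t, x)) \<in> Lp_fun p M"
  by (rule Lp_fun_cong_AE[OF rep_Lp(1)[OF in_Lp]]) (auto intro: U_version)

lemma norm_U_diff:
  assumes "0 \<le> t" and X [measurable]: "g \<in> borel_measurable M"
  shows "Lp_norm p M (\<lambda>x. U (t, x) - g x) = Lp_norm p M (\<lambda>x. rep (u t) x - g x)"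
proof -
  note [measurable] = in_Lp[OF assms(1), THEN rep_measurable]
  show ?thesis
    by (rule Lp_norm_cong_AE) (use U_version[OF assms(1)] in \<open>auto elim!: eventually_mono\<close>)
qed

lemma norm_U_le:
  obtains C where "0 \<le> C" "\<And>t. t \<in> {0..T} \<Longrightarrow> Lp_norm p M (\<lambda>x. U (t, x)) \<le> C"
proof -
  obtain C where C: "0 \<le> C" "\<And>t. t \<in> {0..T} \<Longrightarrow> Lp_norm p M (rep (u t)) \<le> C"
    by (rule norm_bounded[of T]) blast
  have "Lp_norm p M (\<lambda>x. U (t, x)) \<le> C" if "t \<in> {0..T}" for t
    using norm_U_diff[of t "\<lambda>_. 0"] C(2)[OF that] that by simp
  with C(1) show ?thesis
    by (rule that)
qed

lemma integral_measurable [measurable]: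
  "(\<lambda>x. \<integral>t. indicator {a..b} t * U (t, x) \<partial>lborel) \<in> borel_measurable M"
proof -
  note [measurable] = U_measurable_lborel
  show ?thesis
    by measurable
qed

lemma
  assumes "0 \<le> a" "a \<le> b"
  shows AE_integrable_U: "AE x in M. integrable lborel (\<lambda>t. indicator {a..b} t * U (t, x))"
    and integral_Lp_fun: "(\<lambda>x. \<integral>t. indicator {a..b} t * U (t, x) \<partial>lborel) \<in> Lp_fun p M"
proof -
  obtain C where C: "0 \<le> C" "\<And>t. t \<in> {0..b} \<Longrightarrow> Lp_norm p M (\<lambda>x. U (t, x)) \<le> C"
    by (rule norm_U_le[of b]) blast
  note * = sigma_finite_M p assms(2) C(1) U_measurable
  show "AE x in M. integrable lborel (\<lambda>t. indicator {a..b} t * U (t, x))"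
    by (rule Lp_fun_integral_Icc(1)[OF *]) (use assms C in \<open>auto intro: U_section_Lp_fun\<close>)
  show "(\<lambda>x. \<integral>t. indicator {a..b} t * U (t, x) \<partial>lborel) \<in> Lp_fun p M"
    by (rule Lp_fun_integral_Icc(2)[OF *]) (use assms C in \<open>auto intro: U_section_Lp_fun\<close>)
qed

lemma curve_integral_in_Lp: "0 \<le> a \<Longrightarrow> a \<le> b \<Longrightarrow> curve_integral a b \<in> Lp p M"
  unfolding curve_integral_def by (intro ae_class_in_Lp integral_Lp_fun)

lemma curve_integral_refl: "curve_integral a a = Lp_zero M"
proof -
  have "(\<integral>t. indicator {a..a} t * U (t, x) \<partial>lborel) = 0" for x
    by (rule integral_eq_zero_AE)
      (use AE_lborel_singleton[of a] in \<open>auto elim!: eventually_mono\<close>)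
  then show ?thesis
    by (simp add: curve_integral_def Lp_zero_def)
qed

lemma curve_integral_split:
  assumes "0 \<le> a" "a \<le> b" "b \<le> c"
  shows "Lp_add M (curve_integral a b) (curve_integral b c) = curve_integral a c"
proof -
  have bc: "0 \<le> b" "a \<le> c"
    using assms by auto
  have "AE x in M. (\<integral>t. indicator {a..b} t * U (t, x) \<partial>lborel) + (\<integral>t. indicator {b..c} t * U (t, x) \<partial>lborel)
      = (\<integral>t. indicator {a..c} t * U (t, x) \<partial>lborel)"
    using AE_integrable_U[OF assms(1,2)] AE_integrable_U[OF bc(1) assms(3)] AE_integrable_U[OF assms(1) bc(2)]
  proof eventually_elim
    case (elim x)
    \<comment> \<open>The two closed intervals share the point \<open>b\<close>, where the
      indicators add up to 2.\<close>
    have ae: "AE t in lborel. indicator {a..b} t * U (t, x) + indicator {b..c} t * U (t, x)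
        = indicator {a..c} t * U (t, x)"
      using AE_lborel_singleton[of b] by eventually_elim (use assms in \<open>auto split: split_indicator\<close>)
    have "(\<integral>t. indicator {a..b} t * U (t, x) \<partial>lborel) + (\<integral>t. indicator {b..c} t * U (t, x) \<partial>lborel)
        = (\<integral>t. indicator {a..b} t * U (t, x) + indicator {b..c} t * U (t, x) \<partial>lborel)"
      by (rule Bochner_Integration.integral_add[symmetric]) (use elim in auto)
    also have "\<dots> = (\<integral>t. indicator {a..c} t * U (t, x) \<partial>lborel)"
      by (rule integral_cong_AE) (use elim ae in auto)
    finally show ?case .
  qed
  then show ?thesis
    unfolding curve_integral_def by (subst Lp_add_ae_class; (subst ae_class_eq_iff)?) auto
qed

text \<open>Minkowski's inequality for integrals, applied to \<open>U\<close> minus the constant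
  curve \<open>X\<close>. Both the convergence of Riemann sums and the convergence of time averages
  rest on this estimate.\<close>

lemma curve_integral_approx:
  assumes ab: "0 \<le> a" "a \<le> b" and X: "X \<in> Lp p M"
    and e: "\<And>t. t \<in> {a..b} \<Longrightarrow> Lp_dist p M (u t) X \<le> e"
  shows "Lp_dist p M (curve_integral a b) (Lp_scale M (b - a) X) \<le> (b - a) * e"
proof -
  note [measurable] = X[THEN rep_measurable] U_measurable
  have e0: "0 \<le> e"
    using e[of a] ab order_trans[OF Lp_dist_nonneg] by auto
  let ?W = "\<lambda>z. U z - rep X (snd z)"
  have W: "Lp_norm p M (\<lambda>x. \<integral>t. indicator {a..b} t * ?W (t, x) \<partial>lborel) \<le> (b - a) * e"
  proof (rule Lp_fun_integral_Icc(3)[OF sigma_finite_M p ab(2) e0])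
    show "?W \<in> borel_measurable (borel \<Otimes>\<^sub>M M)"
      by measurable
    fix t assume t: "t \<in> {a..b}"
    then show "(\<lambda>x. ?W (t, x)) \<in> Lp_fun p M"
      using ab by (auto intro!: Lp_fun_diff[OF p1] U_section_Lp_fun rep_Lp X)
    show "Lp_norm p M (\<lambda>x. ?W (t, x)) \<le> e"
      using norm_U_diff[of t "rep X"] e[OF t] t ab by (simp add: Lp_dist_eq_norm)
  qed
  have "AE x in M. (\<integral>t. indicator {a..b} t * U (t, x) \<partial>lborel) - (b - a) * rep X x =
      (\<integral>t. indicator {a..b} t * ?W (t, x) \<partial>lborel)"
    using AE_integrable_U[OF ab]
  proof eventually_elim
    case (elim x)
    have "integrable lborel (\<lambda>t. indicator {a..b} t * rep X x)"
      using ab by (intro integrable_mult_left) auto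
    then show ?case
      using elim ab by (simp add: right_diff_distrib)
  qed
  moreover have "(\<lambda>x. \<integral>t. indicator {a..b} t * ?W (t, x) \<partial>lborel) \<in> borel_measurable M"
  proof -
    note [measurable] = U_measurable_lborel
    show ?thesis by measurable
  qed
  ultimately have "Lp_norm p M (\<lambda>x. (\<integral>t. indicator {a..b} t * U (t, x) \<partial>lborel) - (b - a) * rep X x) \<le> (b - a) * e"
    using W by (subst Lp_norm_cong_AE) auto
  then show ?thesis
    unfolding curve_integral_def Lp_scale_def by (subst Lp_dist_ae_class_norm) auto
qed

lemma pairing_U:
  assumes "0 \<le> t" and Y: "Y \<in> Lp (conj_exp p) M"
  shows "(\<integral>x. U (t, x) * rep Y x \<partial>M) = Lp_pairing M (u t) Y"
proof -
  note [measurable] = Y[THEN rep_measurable] in_Lp[OF assms(1), THEN rep_measurable]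
  show ?thesis
    unfolding Lp_pairing_def
    by (rule integral_cong_AE) (use U_version[OF assms(1)] in \<open>auto elim!: eventually_mono\<close>)
qed

lemma pairing_curve_integral:
  assumes ab: "0 \<le> a" "a \<le> b" and Y: "Y \<in> Lp (conj_exp p) M"
  shows "Lp_pairing M (curve_integral a b) Y = integral {a..b} (\<lambda>t. Lp_pairing M (u t) Y)"
proof -
  interpret sigma_finite_measure M
    by (rule sigma_finite_M)
  interpret pair_sigma_finite lborel M ..
  note [measurable] = U_measurable_lborel Y[THEN rep_measurable]
  obtain C where C: "0 \<le> C" "\<And>t. t \<in> {0..b} \<Longrightarrow> Lp_norm p M (\<lambda>x. U (t, x)) \<le> C"
    by (rule norm_U_le[of b]) blast
  have UY: "integrable M (\<lambda>x. U (t, x) * rep Y x)" if "t \<in> {a..b}" for t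
    using that ab by (intro Holder_integrable[OF p] U_section_Lp_fun rep_Lp Y) auto
  \<comment> \<open>The hypothesis of Fubini's theorem: Hoelder in \<open>x\<close> bounds the slice
    at time \<open>t\<close> by a constant, and the time interval is bounded.\<close>
  have i: "integrable (lborel \<Otimes>\<^sub>M M) (\<lambda>(t, x). indicator {a..b} t * U (t, x) * rep Y x)"
  proof (rule Fubini_integrable)
    show "integrable lborel (\<lambda>t. \<integral>x. norm (case (t, x) of (t, x) \<Rightarrow> indicator {a..b} t * U (t, x) * rep Y x) \<partial>M)"
    proof (rule Bochner_Integration.integrable_bound)
      show "integrable lborel (\<lambda>t. indicator {a..b} t * (C * Lp_norm (conj_exp p) M (rep Y)))"
        using ab by (intro integrable_mult_left) auto
      have "(\<integral>x. \<bar>indicator {a..b} t * U (t, x) * rep Y x\<bar> \<partial>M)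
          \<le> indicator {a..b} t * (C * Lp_norm (conj_exp p) M (rep Y))" for t
      proof (cases "t \<in> {a..b}")
        case True
        have "(\<integral>x. \<bar>U (t, x) * rep Y x\<bar> \<partial>M) \<le> Lp_norm p M (\<lambda>x. U (t, x)) * Lp_norm (conj_exp p) M (rep Y)"
          using True ab by (intro Holder_inequality_abs p U_section_Lp_fun rep_Lp Y) auto
        also have "\<dots> \<le> C * Lp_norm (conj_exp p) M (rep Y)"
          using C(2)[of t] True ab by (intro mult_right_mono) auto
        finally show ?thesis
          using True by simp
      qed simp
      then show "AE t in lborel. norm (\<integral>x. norm (case (t, x) of (t, x) \<Rightarrow> indicator {a..b} t * U (t, x) * rep Y x) \<partial>M)
          \<le> norm (indicator {a..b} t * (C * Lp_norm (conj_exp p) M (rep Y)))"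
        by (intro AE_I2) (auto intro: order_trans[OF _ abs_ge_self])
    qed measurable
    have "integrable M (\<lambda>x. indicator {a..b} t * U (t, x) * rep Y x)" for t
      using UY[of t] by (cases "t \<in> {a..b}") auto
    then show "AE t in lborel. integrable M (\<lambda>x. case (t, x) of (t, x) \<Rightarrow> indicator {a..b} t * U (t, x) * rep Y x)"
      by simp
  qed measurable
  have "Lp_pairing M (curve_integral a b) Y = Lp_pairing M (curve_integral a b) (ae_class M (rep Y))"
    using rep_Lp(2)[OF Y] by simp
  also have "\<dots> = (\<integral>x. (\<integral>t. indicator {a..b} t * U (t, x) \<partial>lborel) * rep Y x \<partial>M)"
    unfolding curve_integral_def by (rule Lp_pairing_ae_class) auto
  also have "\<dots> = (\<integral>x. (\<integral>t. indicator {a..b} t * U (t, x) * rep Y x \<partial>lborel) \<partial>M)"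
    by simp
  also have "\<dots> = (\<integral>t. (\<integral>x. indicator {a..b} t * U (t, x) * rep Y x \<partial>M) \<partial>lborel)"
    by (rule Fubini_integral[OF i])
  also have "\<dots> = (LINT t:{a..b}|lborel. Lp_pairing M (u t) Y)"
    unfolding set_lebesgue_integral_def
  proof (rule Bochner_Integration.integral_cong[OF refl])
    fix t
    show "(\<integral>x. indicator {a..b} t * U (t, x) * rep Y x \<partial>M) = indicator {a..b} t *\<^sub>R Lp_pairing M (u t) Y"
      using pairing_U[OF _ Y, of t] ab by (auto split: split_indicator)
  qed
  \<comment> \<open>The integrand is continuous, so its Lebesgue integral agrees with the gauge
    integral, the form to which the fundamental theorem of calculus applies later.\<close>
  also have "\<dots> = integral {a..b} (\<lambda>t. Lp_pairing M (u t) Y)"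
    by (intro set_borel_integral_eq_integral borel_integrable_atLeastAtMost'
        continuous_on_subset[OF pairing_continuous[OF Y]]) (use ab in auto)
  finally show ?thesis .
qed

text \<open>Each grid cell contributes an error of at most \<open>h * e\<close>, by
  \<open>curve_integral_approx\<close>. The induction runs over \<open>k\<close> while
  \<open>n\<close> stays fixed, so that the hypothesis on the whole interval remains
  available.\<close>

lemma Riemann_sum_approx:
  fixes a h :: real
  assumes a: "0 \<le> a" and h: "0 \<le> h"
    and e: "\<And>s t. s \<in> {a..a + n * h} \<Longrightarrow> t \<in> {a..a + n * h} \<Longrightarrow> \<bar>s - t\<bar> \<le> h \<Longrightarrow> Lp_dist p M (u s) (u t) \<le> e"
    and k: "k \<le> n"
  shows "Lp_dist p M (Lp_sum M (\<lambda>j. Lp_scale M h (u (a + j * h))) k) (curve_integral a (a + k * h)) \<le> k * h * e"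
  using k
proof (induction k)
  case 0
  then show ?case
    using Lp_dist_eq_0_iff[OF p1 Lp_zero_in_Lp Lp_zero_in_Lp, of M] p1 by (simp add: curve_integral_refl)
next
  case (Suc k)
  let ?v = "\<lambda>j::nat. Lp_scale M h (u (a + j * h))"
  define b c :: real where "b = a + k * h" and "c = a + Suc k * h"
  have kh: "0 \<le> k * h"
    using h by simp
  have cn: "Suc k * h \<le> n * h"
    using Suc.prems h by (intro mult_right_mono) auto
  have bc: "0 \<le> b" "a \<le> b" "b \<le> c" "c - b = h" "c \<le> a + n * h"
    using a h kh cn by (auto simp: b_def c_def algebra_simps)
  have ub: "u b \<in> Lp p M"
    by (intro in_Lp bc)
  have v: "?v j \<in> Lp p M" for j
    using a h by (intro Lp_scale_in_Lp p1 in_Lp) auto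
  have "Lp_dist p M (u t) (u b) \<le> e" if "t \<in> {b..c}" for t
    using that bc by (intro e) auto
  then have "Lp_dist p M (curve_integral b c) (Lp_scale M h (u b)) \<le> h * e"
    using curve_integral_approx[OF bc(1,3) ub, of e] bc(4) by simp
  moreover have "Lp_dist p M (Lp_sum M ?v (Suc k)) (curve_integral a c)
      \<le> Lp_dist p M (Lp_sum M ?v k) (curve_integral a b) + Lp_dist p M (?v k) (curve_integral b c)"
    unfolding curve_integral_split[OF a bc(2,3), symmetric] Lp_sum.simps
    by (intro Lp_dist_add_le Lp_sum_in_Lp p1 v curve_integral_in_Lp a bc)
  ultimately have "Lp_dist p M (Lp_sum M ?v (Suc k)) (curve_integral a c) \<le> k * h * e + h * e"
    using Suc.IH Suc.prems by (simp add: b_def Lp_dist_commute)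
  then show ?case
    by (simp add: c_def algebra_simps)
qed

end

section \<open>Orbits of strongly continuous semigroups\<close>

locale Lp_semigroup =
  fixes M :: "'a measure" and p :: real and S
  assumes sigma_finite_M: "sigma_finite_measure M"
    and p: "1 < p"
    and semigroup: "C0_semigroup p M S"
begin

lemma p1: "1 \<le> p"
  using p by simp

lemma linear: "0 \<le> t \<Longrightarrow> Lp_linear_on p M (Lp p M) (S t)"
  and semigroup_zero: "X \<in> Lp p M \<Longrightarrow> S 0 X = X"
  and semigroup_add: "0 \<le> s \<Longrightarrow> 0 \<le> t \<Longrightarrow> X \<in> Lp p M \<Longrightarrow> S (s + t) X = S s (S t X)"
  using semigroup unfolding C0_semigroup_def by blast+

lemma in_Lp: "0 \<le> t \<Longrightarrow> X \<in> Lp p M \<Longrightarrow> S t X \<in> Lp p M"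
  using linear[of t] unfolding Lp_linear_on_def by blast

lemma curve: "X \<in> Lp p M \<Longrightarrow> Lp_curve M p (\<lambda>t. S t X)"
  using semigroup sigma_finite_M p unfolding C0_semigroup_def Lp_curve_def by blast

lemma continuous:
  assumes t: "0 \<le> t" and X: "X \<in> Lp p M" and e: "0 < e"
  shows "\<exists>d>0. \<forall>Z. Z \<in> Lp p M \<and> Lp_dist p M X Z < d \<longrightarrow> Lp_dist p M (S t X) (S t Z) < e"
proof -
  have "continuous_map (Lp_topology p M) (Lp_topology p M) (S t)"
    using semigroup t unfolding C0_semigroup_def by blast
  then show ?thesis
    using X e
    unfolding Lp_topology_def Metric_space.metric_continuous_map[OF Metric_space_Lp[OF p1] Metric_space_Lp[OF p1]]
    by simp
qed

end

locale Lp_orbit = Lp_semigroup +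
  fixes X U
  assumes X: "X \<in> Lp p M"
    and version: "Lp_curve_version M p (\<lambda>t. S t X) U"

sublocale Lp_orbit \<subseteq> orbit: Lp_curve_version M p "\<lambda>t. S t X" U
  by (rule version)

context Lp_orbit
begin

text \<open>\<open>S r\<close> maps Riemann sums of the orbit to Riemann sums of the shifted orbit; both converge in \<open>L\<^sup>p(M)\<close>.\<close>

lemma shift_curve_integral:
  assumes r: "0 \<le> r" and ab: "0 \<le> a" "a < b"
  shows "S r (orbit.curve_integral a b) = orbit.curve_integral (a + r) (b + r)"
proof -
  let ?I = "orbit.curve_integral a b" and ?J = "orbit.curve_integral (a + r) (b + r)"
  have I: "?I \<in> Lp p M" and J: "?J \<in> Lp p M" and SI: "S r ?I \<in> Lp p M"
    using ab r by (auto intro!: orbit.curve_integral_in_Lp in_Lp)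
  show ?thesis
  proof (rule Lp_eqI_dist[OF p1 SI J])
    fix e :: real assume e: "0 < e"
    obtain \<delta> where \<delta>: "0 < \<delta>"
      "\<forall>Z. Z \<in> Lp p M \<and> Lp_dist p M ?I Z < \<delta> \<longrightarrow> Lp_dist p M (S r ?I) (S r Z) < e / 2"
      using continuous[OF r I half_gt_zero[OF e]] by blast
    \<comment> \<open>The total error of a Riemann sum is at most
      \<open>(b - a) * \<epsilon>\<close>. It has to be below \<open>\<delta>\<close> before
      \<open>S r\<close> is applied and at most \<open>e / 2\<close> for the shifted orbit.\<close>
    define \<epsilon> where "\<epsilon> = min (\<delta> / 2) (e / 2) / (b - a)"
    have \<epsilon>: "0 < \<epsilon>" "(b - a) * \<epsilon> < \<delta>" "(b - a) * \<epsilon> \<le> e / 2"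
      using e \<delta>(1) ab by (auto simp: \<epsilon>_def)
    \<comment> \<open>The interval \<open>{0..b + r}\<close> contains both \<open>[a, b]\<close> and
      its shift by \<open>r\<close>, so one mesh serves both Riemann sums.\<close>
    obtain d where d: "0 < d" "\<And>s t. s \<in> {0..b + r} \<Longrightarrow> t \<in> {0..b + r} \<Longrightarrow> \<bar>s - t\<bar> < d \<Longrightarrow>
        Lp_dist p M (S s X) (S t X) < \<epsilon>"
      by (rule orbit.uniformly_continuous[OF \<epsilon>(1), of "b + r"]) blast
    obtain n :: nat where n: "(b - a) / d < n"
      using reals_Archimedean2 by blast
    have "0 < (b - a) / d"
      using ab d(1) by simp
    with n have n0: "0 < real n"
      by linarith
    define h where "h = (b - a) / n"
    have h: "0 \<le> h" "h < d" "n * h = b - a"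
      using n n0 ab d(1) by (auto simp: h_def field_simps)
    \<comment> \<open>Stated for an arbitrary starting point \<open>c\<close>, because it is used
      for \<open>c = a\<close> and for \<open>c = a + r\<close>.\<close>
    have approx: "Lp_dist p M (Lp_sum M (\<lambda>j. Lp_scale M h (S (c + j * h) X)) n) (orbit.curve_integral c (c + (b - a)))
        \<le> (b - a) * \<epsilon>" if c: "0 \<le> c" "c + (b - a) \<le> b + r" for c
    proof -
      have *: "Lp_dist p M (S s X) (S t X) \<le> \<epsilon>"
        if "s \<in> {c..c + n * h}" "t \<in> {c..c + n * h}" "\<bar>s - t\<bar> \<le> h" for s t
        using that c h by (intro less_imp_le d(2)) auto
      have "Lp_dist p M (Lp_sum M (\<lambda>j. Lp_scale M h (S (c + j * h) X)) n) (orbit.curve_integral c (c + n * h))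
          \<le> n * h * \<epsilon>"
        by (rule orbit.Riemann_sum_approx[OF c(1) h(1) * order_refl])
      then show ?thesis
        using h(3) by simp
    qed
    let ?Z = "Lp_sum M (\<lambda>j. Lp_scale M h (S (a + j * h) X)) n"
    have v: "Lp_scale M h (S (a + j * h) X) \<in> Lp p M" for j :: nat
      using ab h by (intro Lp_scale_in_Lp[OF p1] in_Lp X) auto
    have Z: "?Z \<in> Lp p M"
      by (rule Lp_sum_in_Lp[OF p1 v])
    \<comment> \<open>Linearity moves \<open>S r\<close> past the weight \<open>h\<close>, and the
      semigroup law shifts the sampling time.\<close>
    have "S r (Lp_scale M h (S (a + j * h) X)) = Lp_scale M h (S (a + r + j * h) X)" for j :: nat
    proof -
      have s: "0 \<le> a + j * h"
        using ab h by simp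
      have "S r (Lp_scale M h (S (a + j * h) X)) = Lp_scale M h (S r (S (a + j * h) X))"
        using linear[OF r] in_Lp[OF s X] by (simp add: Lp_linear_on_def)
      also have "S r (S (a + j * h) X) = S (a + r + j * h) X"
        using semigroup_add[OF r s X] by (simp add: algebra_simps)
      finally show ?thesis .
    qed
    then have SZ: "S r ?Z = Lp_sum M (\<lambda>j. Lp_scale M h (S (a + r + j * h) X)) n"
      using Lp_linear_on_sum[OF p1 linear[OF r] v] by simp
    have "Lp_dist p M ?I ?Z < \<delta>"
      using approx[of a] ab r \<epsilon>(2) by (simp add: Lp_dist_commute)
    then have "Lp_dist p M (S r ?I) (S r ?Z) < e / 2"
      using \<delta>(2) Z by simp
    moreover have "Lp_dist p M (S r ?Z) ?J \<le> e / 2"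
    proof -
      have "a + r + (b - a) = b + r"
        by simp
      with approx[of "a + r"] ab r \<epsilon>(3) show ?thesis
        unfolding SZ by simp
    qed
    ultimately show "Lp_dist p M (S r ?I) ?J \<le> e"
      using Lp_dist_triangle[OF p1 SI in_Lp[OF r Z] J] by linarith
  qed
qed

text \<open>\<open>S h\<close> shifts the interval \<open>[0, t]\<close> to
  \<open>[h, t + h]\<close>. After cancellation the difference quotient is the average of the orbit
  over \<open>[t, t + h]\<close> minus its average over \<open>[0, h]\<close>, and these tend to
  \<open>S t X\<close> and \<open>X\<close>.\<close>

lemma curve_integral_in_generator:
  assumes t: "0 < t"
  shows "(orbit.curve_integral 0 t, Lp_diff M (S t X) X) \<in> semigroup_generator p M S"
proof -
  interpret Metric_space "Lp p M" "Lp_dist p M"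
    by (rule Metric_space_Lp[OF p1])
  let ?I = "orbit.curve_integral"
  have St: "S t X \<in> Lp p M"
    using t by (intro in_Lp X) auto
  have mean: "\<exists>d>0. \<forall>h. 0 < h \<and> h < d \<longrightarrow> Lp_dist p M (Lp_scale M (1 / h) (?I s (s + h))) (S s X) \<le> e"
    if s: "0 \<le> s" and e: "0 < e" for s e
  proof -
    obtain d where d: "0 < d" "\<And>r. 0 \<le> r \<Longrightarrow> \<bar>r - s\<bar> < d \<Longrightarrow> Lp_dist p M (S r X) (S s X) < e"
      using orbit.continuous_at_point[OF s e] by blast
    have "Lp_dist p M (Lp_scale M (1 / h) (?I s (s + h))) (S s X) \<le> e" if h: "0 < h" "h < d" for h
    proof -
      have L: "?I s (s + h) \<in> Lp p M" "S s X \<in> Lp p M" "Lp_scale M h (S s X) \<in> Lp p M"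
        using s h X by (auto intro!: orbit.curve_integral_in_Lp in_Lp Lp_scale_in_Lp[OF p1])
      have "Lp_dist p M (?I s (s + h)) (Lp_scale M (s + h - s) (S s X)) \<le> (s + h - s) * e"
        using s h by (intro orbit.curve_integral_approx L less_imp_le[OF d(2)]) auto
      moreover have "Lp_scale M (1 / h) (Lp_scale M h (S s X)) = S s X"
        using h Lp_scale_scale[OF L(2), of "1 / h" h] Lp_scale_one[OF L(2)] by simp
      then have "h * Lp_dist p M (Lp_scale M (1 / h) (?I s (s + h))) (S s X)
          = Lp_dist p M (?I s (s + h)) (Lp_scale M h (S s X))"
        using Lp_dist_scale[OF p1 L(1,3), of "1 / h" ] h by simp
      ultimately have "h * Lp_dist p M (Lp_scale M (1 / h) (?I s (s + h))) (S s X) \<le> h * e"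
        by simp
      then show ?thesis
        using h by simp
    qed
    with d(1) show ?thesis
      by blast
  qed
  have "limitin mtopology (\<lambda>h. Lp_scale M (1 / h) (Lp_diff M (S h (?I 0 t)) (?I 0 t)))
      (Lp_diff M (S t X) X) (at_right 0)"
    unfolding limitin_metric
  proof (intro conjI allI impI)
    show "Lp_diff M (S t X) X \<in> Lp p M"
      by (intro Lp_diff_in_Lp p1 St X)
    fix e :: real assume e: "0 < e"
    \<comment> \<open>\<open>mean\<close> gives only non-strict bounds; with \<open>e / 3\<close>
      the two errors still add up to less than \<open>e\<close>.\<close>
    obtain d1 where d1: "d1 > 0"
      "\<And>h. 0 < h \<Longrightarrow> h < d1 \<Longrightarrow> Lp_dist p M (Lp_scale M (1 / h) (?I t (t + h))) (S t X) \<le> e / 3"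
      using mean[of t "e / 3"] t e by auto
    obtain d2 where d2: "d2 > 0"
      "\<And>h. 0 < h \<Longrightarrow> h < d2 \<Longrightarrow> Lp_dist p M (Lp_scale M (1 / h) (?I 0 (0 + h))) (S 0 X) \<le> e / 3"
      using mean[of 0 "e / 3"] e by auto
    show "\<forall>\<^sub>F h in at_right 0. Lp_scale M (1 / h) (Lp_diff M (S h (?I 0 t)) (?I 0 t)) \<in> Lp p M \<and>
        Lp_dist p M (Lp_scale M (1 / h) (Lp_diff M (S h (?I 0 t)) (?I 0 t))) (Lp_diff M (S t X) X) < e"
      unfolding eventually_at_right_field
    proof (intro exI[of _ "min d1 d2"] conjI allI impI)
      fix h :: real assume h: "0 < h" "h < min d1 d2"
      have L: "?I 0 t \<in> Lp p M" "?I t (t + h) \<in> Lp p M" "?I 0 h \<in> Lp p M" "?I h (t + h) \<in> Lp p M"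
        using t h by (auto intro!: orbit.curve_integral_in_Lp)
      have "Lp_add M (?I 0 t) (?I t (t + h)) = Lp_add M (?I 0 h) (?I h (t + h))"
        using t h by (subst (1 2) orbit.curve_integral_split) auto
      then have eq: "Lp_diff M (S h (?I 0 t)) (?I 0 t) = Lp_diff M (?I t (t + h)) (?I 0 h)"
        using Lp_diff_eq_if_add_eq[OF p1 L] shift_curve_integral[of h 0 t] t h by simp
      have L': "Lp_scale M (1 / h) (?I t (t + h)) \<in> Lp p M" "Lp_scale M (1 / h) (?I 0 h) \<in> Lp p M"
        by (intro Lp_scale_in_Lp p1 L)+
      show "Lp_scale M (1 / h) (Lp_diff M (S h (?I 0 t)) (?I 0 t)) \<in> Lp p M"
        unfolding eq by (intro Lp_scale_in_Lp Lp_diff_in_Lp p1 L)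
      have "Lp_dist p M (Lp_scale M (1 / h) (?I t (t + h))) (S t X) \<le> e / 3"
        using d1(2) h by simp
      moreover have "Lp_dist p M (Lp_scale M (1 / h) (?I 0 h)) X \<le> e / 3"
        using d2(2)[of h] h semigroup_zero[OF X] by simp
      ultimately show "Lp_dist p M (Lp_scale M (1 / h) (Lp_diff M (S h (?I 0 t)) (?I 0 t))) (Lp_diff M (S t X) X) < e"
        unfolding eq Lp_scale_diff[OF L(2,3)] using Lp_dist_diff_le[OF p1 L' St X] e by linarith
    qed (use d1 d2 in auto)
  qed
  then show ?thesis
    using t by (auto simp: semigroup_generator_def Lp_topology_def intro!: orbit.curve_integral_in_Lp)
qed

text \<open>The adjoint relation is tested on the pair from
  \<open>curve_integral_in_generator\<close>, and the pairing is then moved inside the integral.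
  That pair requires \<open>0 < t\<close>, whence the separate case \<open>t = 0\<close>.\<close>

lemma pairing_orbit:
  assumes t: "0 \<le> t" and adj: "(Y, Z) \<in> Lp_adjoint p M (semigroup_generator p M S)"
  shows "Lp_pairing M (S t X) Y - Lp_pairing M X Y = integral {0..t} (\<lambda>s. Lp_pairing M (S s X) Z)"
proof (cases "t = 0")
  case True
  then show ?thesis
    by (simp add: semigroup_zero[OF X])
next
  case False
  have YZ: "Y \<in> Lp (conj_exp p) M" "Z \<in> Lp (conj_exp p) M"
    using adj by (auto simp: Lp_adjoint_def)
  have "Lp_pairing M (S t X) Y - Lp_pairing M X Y = Lp_pairing M (Lp_diff M (S t X) X) Y"
    by (rule Lp_pairing_diff[OF p in_Lp[OF t X] X YZ(1), symmetric])
  also have "\<dots> = Lp_pairing M (orbit.curve_integral 0 t) Z"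
    using adj curve_integral_in_generator[of t] t False by (auto simp: Lp_adjoint_def)
  also have "\<dots> = integral {0..t} (\<lambda>s. Lp_pairing M (S s X) Z)"
    by (rule orbit.pairing_curve_integral[OF order_refl t YZ(2)])
  finally show ?thesis .
qed

end

text \<open>The identity does not mention the version \<open>U\<close>, so any version provided by
  \<open>joint_version\<close> proves it.\<close>

lemma (in Lp_semigroup) pairing_semigroup:
  assumes X: "X \<in> Lp p M" and t: "0 \<le> t"
    and adj: "(Y, Z) \<in> Lp_adjoint p M (semigroup_generator p M S)"
  shows "Lp_pairing M (S t X) Y - Lp_pairing M X Y = integral {0..t} (\<lambda>s. Lp_pairing M (S s X) Z)"
proof -
  interpret Lp_curve M p "\<lambda>t. S t X"
    by (rule curve[OF X])
  obtain U where "U \<in> borel_measurable (borel \<Otimes>\<^sub>M M)" "\<And>t. 0 \<le> t \<Longrightarrow> AE x in M. U (t, x) = rep (S t X) x"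
    using joint_version by blast
  then interpret Lp_orbit M p S X U
    by unfold_locales (use X in auto)
  show ?thesis
    by (rule pairing_orbit[OF t adj])
qed

section \<open>Uniqueness\<close>

text \<open>The classes annihilated by \<open>W\<close> form a subspace, which therefore contains
  the span of \<open>G\<close>. Hoelder's inequality carries annihilation over to the closure, that
  is, to all classes. Testing with the dual element of \<open>W\<close> makes the integral of
  \<open>\<bar>W z\<bar> powr p\<close> vanish.\<close>

lemma Lp_dense_annihilator:
  assumes p: "1 < p" and W: "W \<in> Lp_fun p N"
    and G: "G \<subseteq> Lp (conj_exp p) N"
    and dense: "Lp_dense (conj_exp p) N (Lp_span (conj_exp p) N G)"
    and ann: "\<And>Y. Y \<in> G \<Longrightarrow> (\<integral>z. W z * rep Y z \<partial>N) = 0"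
  shows "AE z in N. W z = 0"
proof -
  define q where "q = conj_exp p"
  have q: "1 \<le> q" and pq: "p / q = p - 1"
    using conj_exp_gt_1[OF p] p by (auto simp: q_def conj_exp_def field_simps)
  note WY = Holder_integrable[OF p W, folded q_def]
  have [measurable]: "W \<in> borel_measurable N"
    using W by (rule Lp_fun_measurable)
  define Z where "Z = {Y \<in> Lp q N. (\<integral>z. W z * rep Y z \<partial>N) = 0}"
  have int_class: "(\<integral>z. W z * rep (ae_class N g) z \<partial>N) = (\<integral>z. W z * g z \<partial>N)"
    if g [measurable]: "g \<in> borel_measurable N" for g
  proof -
    note [measurable] = rep_ae_class(1)[OF g]
    show ?thesis
      by (rule integral_cong_AE) (use rep_ae_class(2)[OF g] in \<open>auto elim!: eventually_mono\<close>)
  qed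
  have "Lp_subspace q N Z"
    unfolding Lp_subspace_def
  proof (intro conjI ballI allI)
    show "Z \<subseteq> Lp q N"
      by (auto simp: Z_def)
    show "Lp_zero N \<in> Z"
      using Lp_zero_in_Lp[OF q] by (simp add: Z_def Lp_zero_def int_class)
  next
    fix Y1 Y2 assume Y: "Y1 \<in> Z" "Y2 \<in> Z"
    then have L: "Y1 \<in> Lp q N" "Y2 \<in> Lp q N"
      by (auto simp: Z_def)
    note [measurable] = L[THEN rep_measurable]
    show "Lp_add N Y1 Y2 \<in> Z"
      using Lp_add_in_Lp[OF q L] Y WY[OF rep_Lp(1)[OF L(1)]] WY[OF rep_Lp(1)[OF L(2)]]
      by (simp add: Z_def Lp_add_def int_class distrib_left)
  next
    fix c Y assume Y: "Y \<in> Z"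
    then have L: "Y \<in> Lp q N"
      by (auto simp: Z_def)
    note [measurable] = L[THEN rep_measurable]
    have "(\<integral>z. W z * (c * rep Y z) \<partial>N) = c * (\<integral>z. W z * rep Y z \<partial>N)"
      by (subst integral_mult_right_zero[symmetric]) (simp add: algebra_simps)
    then show "Lp_scale N c Y \<in> Z"
      using Lp_scale_in_Lp[OF q L] Y by (simp add: Z_def Lp_scale_def int_class)
  qed
  moreover have "G \<subseteq> Z"
    using G ann by (auto simp: Z_def q_def)
  ultimately have span: "Lp_span q N G \<subseteq> Z"
    unfolding Lp_span_def by (intro hull_minimal)
  interpret Metric_space "Lp q N" "Lp_dist q N"
    by (rule Metric_space_Lp[OF q])
  have zero: "(\<integral>z. W z * rep Y z \<partial>N) = 0" if Y: "Y \<in> Lp q N" for Y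
  proof -
    have "\<bar>\<integral>z. W z * rep Y z \<partial>N\<bar> \<le> 0"
    proof (rule field_le_epsilon)
      fix e :: real assume e: "0 < e"
      \<comment> \<open>The summand 1 makes \<open>K\<close> a valid divisor even if
        \<open>W\<close> has norm 0.\<close>
      define K where "K = Lp_norm p N W + 1"
      have K: "0 < K"
        unfolding K_def by (simp add: add_nonneg_pos)
      have "Y \<in> mtopology closure_of (Lp_span q N G)"
        using dense Y by (simp add: Lp_dense_def Lp_topology_def q_def)
      then obtain Y' where Y': "Y' \<in> Lp_span q N G" "Y' \<in> mball Y (e / K)"
        unfolding metric_closure_of using divide_pos_pos[OF e K] by blast
      then have L: "Y' \<in> Lp q N" "(\<integral>z. W z * rep Y' z \<partial>N) = 0" "Lp_dist q N Y Y' < e / K"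
        using span by (auto simp: Z_def)
      have "(\<integral>z. W z * rep Y z \<partial>N) = (\<integral>z. W z * (rep Y z - rep Y' z) \<partial>N)"
        using L WY[OF rep_Lp(1)[OF Y]] WY[OF rep_Lp(1)[OF L(1)]] by (simp add: right_diff_distrib)
      also have "\<bar>\<dots>\<bar> \<le> Lp_norm p N W * Lp_dist q N Y Y'"
        unfolding Lp_dist_eq_norm unfolding q_def
        by (intro Holder_inequality p W Lp_fun_diff rep_Lp Y[unfolded q_def] L(1)[unfolded q_def] q[unfolded q_def])
      also have "\<dots> \<le> K * Lp_dist q N Y Y'"
        by (intro mult_right_mono) (auto simp: K_def)
      also have "\<dots> \<le> e"
        using L(3) K by (simp add: field_simps)
      finally show "\<bar>\<integral>z. W z * rep Y z \<partial>N\<bar> \<le> 0 + e"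
        by simp
    qed
    then show ?thesis
      by simp
  qed
  \<comment> \<open>the duality map: \<open>W g = |W|\<^sup>p\<close> and \<open>|g|\<^sup>q = |W|\<^sup>p\<close>\<close>
  define g where "g z = sgn (W z) * \<bar>W z\<bar> powr (p / q)" for z
  have "\<bar>g z\<bar> powr q = \<bar>W z\<bar> powr p" for z
    using q p by (cases "W z = 0") (auto simp: g_def abs_mult powr_powr)
  then have g: "g \<in> Lp_fun q N"
    using W by (simp add: Lp_fun_def g_def[abs_def])
  have "W z * g z = \<bar>W z\<bar> powr p" for z
  proof (cases "W z = 0")
    case False
    have "W z * g z = \<bar>W z\<bar> powr 1 * \<bar>W z\<bar> powr (p / q)"
      using False abs_sgn[of "W z"] by (simp add: g_def mult.assoc[symmetric])
    also have "\<dots> = \<bar>W z\<bar> powr p"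
      by (simp only: powr_add[symmetric] pq) simp
    finally show ?thesis .
  qed (simp add: g_def)
  then have "(\<integral>z. \<bar>W z\<bar> powr p \<partial>N) = 0"
    using zero[OF ae_class_in_Lp[OF g]] int_class[OF Lp_fun_measurable[OF g]] by simp
  then show ?thesis
    using p W by (intro Lp_norm_eq_0_AE[of p]) (auto simp: Lp_norm_def)
qed

section \<open>Integrals over time and over time-space\<close>

lemma finite_measure_restrict_lborel_Icc: "finite_measure (restrict_space lborel {a..b :: real})"
  by (rule finite_measureI) (cases "a \<le> b"; simp add: space_restrict_space emeasure_restrict_space)

lemma continuous_on_Icc_measurable_restrict:
  "continuous_on {a..b :: real} f \<Longrightarrow> f \<in> borel_measurable (restrict_space lborel {a..b})"
  for f :: "real \<Rightarrow> real"
  using borel_measurable_continuous_on_restrict[of "{a..b}" f]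
  by (simp cong: measurable_cong_sets add: sets_restrict_space)

text \<open>Links the measure on the time factor of \<open>time_space\<close> with the gauge
  integral used for integration by parts.\<close>

lemma integral_restrict_Icc:
  fixes f :: "real \<Rightarrow> real"
  assumes "continuous_on {a..b} f"
  shows "integral\<^sup>L (restrict_space lborel {a..b}) f = integral {a..b} f"
proof -
  have "integral\<^sup>L (restrict_space lborel {a..b}) f = (LINT t:{a..b}|lborel. f t)"
    by (simp add: integral_restrict_space set_lebesgue_integral_def)
  also have "\<dots> = integral {a..b} f"
    by (intro set_borel_integral_eq_integral borel_integrable_atLeastAtMost' assms)
  finally show ?thesis .
qed

text \<open>An open interval to the right of \<open>t0\<close> is not a null set, so it contains
  times at which the curves agree; continuity of both curves transfers this to
  \<open>t0\<close>.\<close>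

lemma (in Lp_curve) eq_if_AE_eq:
  assumes v: "Lp_curve M p v" and T: "0 \<le> t0" "t0 < T"
    and ae: "AE t in restrict_space lborel {0..T}. u t = v t"
  shows "u t0 = v t0"
proof -
  interpret v: Lp_curve M p v
    by fact
  have "Lp_dist p M (u t0) (v t0) \<le> e" if e: "0 < e" for e
  proof -
    obtain d1 where d1: "0 < d1" "\<And>r. 0 \<le> r \<Longrightarrow> \<bar>r - t0\<bar> < d1 \<Longrightarrow> Lp_dist p M (u r) (u t0) < e / 2"
      using continuous_at_point[OF T(1), of "e / 2"] e by auto
    obtain d2 where d2: "0 < d2" "\<And>r. 0 \<le> r \<Longrightarrow> \<bar>r - t0\<bar> < d2 \<Longrightarrow> Lp_dist p M (v r) (v t0) < e / 2"
      using v.continuous_at_point[OF T(1), of "e / 2"] e by auto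
    \<comment> \<open>The bound \<open>T - t0\<close> keeps the interval inside
      \<open>{0..T}\<close>, where the almost everywhere statement applies.\<close>
    define d where "d = min (min d1 d2) (T - t0)"
    have d: "0 < d" "d \<le> d1" "d \<le> d2" "t0 + d \<le> T"
      using d1(1) d2(1) T by (auto simp: d_def)
    have "\<exists>t\<in>{t0<..<t0 + d}. u t = v t"
    proof (rule ccontr)
      assume none: "\<not> (\<exists>t\<in>{t0<..<t0 + d}. u t = v t)"
      have "AE t in lborel. t \<in> {0..T} \<longrightarrow> u t = v t"
        using ae by (simp add: AE_restrict_space_iff)
      then have "AE t in lborel. t \<notin> {t0<..<t0 + d}"
        by eventually_elim (use none d T in auto)
      then have "emeasure lborel {t0<..<t0 + d} = 0"
        by (subst (asm) AE_iff_measurable[of "{t0<..<t0 + d}"]) auto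
      then show False
        using d(1) by simp
    qed
    then obtain t where t: "t0 < t" "t < t0 + d" "u t = v t"
      by auto
    have L: "u t0 \<in> Lp p M" "u t \<in> Lp p M" "v t0 \<in> Lp p M"
      using T t by (auto intro: in_Lp v.in_Lp)
    have "Lp_dist p M (u t) (u t0) < e / 2" "Lp_dist p M (v t) (v t0) < e / 2"
      using t d T d1(2)[of t] d2(2)[of t] by auto
    then show ?thesis
      using Lp_dist_triangle[OF p1 L] t(3) by (simp add: Lp_dist_commute)
  qed
  then show ?thesis
    by (rule Lp_eqI_dist[OF p1 in_Lp[OF T(1)] v.in_Lp[OF T(1)]])
qed

context Lp_curve_version
begin

lemma U_measurable_time_space: "U \<in> borel_measurable (time_space T M)"
proof -
  have "(\<lambda>t. t) \<in> borel_measurable (restrict_space lborel {0..T})"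
    by (rule measurable_restrict_space1) simp
  then have "(\<lambda>z. (fst z, snd z)) \<in> time_space T M \<rightarrow>\<^sub>M borel \<Otimes>\<^sub>M M"
    unfolding time_space_def by (intro measurable_Pair measurable_compose[OF measurable_fst] measurable_snd)
  from measurable_compose[OF this U_measurable] show ?thesis
    by simp
qed

text \<open>The sections have uniformly bounded norms over a time interval of finite
  measure.\<close>

lemma U_in_Lp_fun_time_space: "U \<in> Lp_fun p (time_space T M)"
proof -
  let ?I = "restrict_space lborel {0..T} :: real measure"
  interpret M: sigma_finite_measure M
    by (rule sigma_finite_M)
  interpret I: finite_measure ?I
    by (rule finite_measure_restrict_lborel_Icc)
  interpret pair_sigma_finite ?I M ..
  have [measurable]: "U \<in> borel_measurable (?I \<Otimes>\<^sub>M M)"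
    using U_measurable_time_space by (simp add: time_space_def)
  obtain C where C: "0 \<le> C" "\<And>t. t \<in> {0..T} \<Longrightarrow> Lp_norm p M (\<lambda>x. U (t, x)) \<le> C"
    by (rule norm_U_le[of T]) blast
  have bound: "(\<integral>x. \<bar>U (t, x)\<bar> powr p \<partial>M) \<le> C powr p" if "t \<in> {0..T}" for t
  proof -
    have "(\<integral>x. \<bar>U (t, x)\<bar> powr p \<partial>M) = Lp_norm p M (\<lambda>x. U (t, x)) powr p"
      using p by (simp add: Lp_norm_powr)
    also have "\<dots> \<le> C powr p"
      using C(2)[OF that] p by (intro powr_mono2) auto
    finally show ?thesis .
  qed
  have "integrable (?I \<Otimes>\<^sub>M M) (\<lambda>z. \<bar>U z\<bar> powr p)"
  proof (rule Fubini_integrable)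
    show "integrable ?I (\<lambda>t. \<integral>x. norm (\<bar>U (t, x)\<bar> powr p) \<partial>M)"
      by (rule I.integrable_const_bound[of _ "C powr p"])
        (use bound in \<open>auto simp: space_restrict_space\<close>)
    show "AE t in ?I. integrable M (\<lambda>x. \<bar>U (t, x)\<bar> powr p)"
      by (rule AE_I2) (use U_section_Lp_fun in \<open>auto simp: space_restrict_space Lp_fun_def\<close>)
  qed measurable
  then show ?thesis
    using U_measurable_time_space by (simp add: Lp_fun_def time_space_def)
qed

text \<open>Fubini's theorem with \<open>x\<close> integrated first: at fixed time the integral
  against the tensors is a combination of two pairings. Hoelder on the product space provides the
  integrability.\<close>

lemma integral_time_space_tensor:
  assumes f: "continuous_on {0..T} f" "continuous_on {0..T} f'"
    and Y: "Y \<in> Lp (conj_exp p) M" "Z \<in> Lp (conj_exp p) M"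
  defines "V \<equiv> Lp_add (time_space T M) (tensor T M f' Y) (tensor T M f Z)"
  shows "(\<integral>z. U z * rep V z \<partial>time_space T M) =
    integral {0..T} (\<lambda>t. f' t * Lp_pairing M (u t) Y + f t * Lp_pairing M (u t) Z)"
proof -
  let ?I = "restrict_space lborel {0..T} :: real measure" and ?q = "conj_exp p"
  interpret M: sigma_finite_measure M
    by (rule sigma_finite_M)
  interpret I: finite_measure ?I
    by (rule finite_measure_restrict_lborel_Icc)
  interpret pair_sigma_finite ?I M ..
  have q: "1 \<le> ?q"
    using conj_exp_gt_1[OF p] by simp
  note [measurable] = f[THEN continuous_on_Icc_measurable_restrict] Y[THEN rep_measurable]
  \<comment> \<open>An explicit representative of \<open>V\<close>; the chosen one,
    \<open>rep V\<close>, agrees with it only almost everywhere, and its sections are not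
    accessible.\<close>
  define H where "H z = f' (fst z) * rep Y (snd z) + f (fst z) * rep Z (snd z)" for z
  have tm: "(\<lambda>(t, x). f' t * rep Y x) \<in> borel_measurable (time_space T M)"
    "(\<lambda>(t, x). f t * rep Z x) \<in> borel_measurable (time_space T M)"
    unfolding time_space_def by measurable
  have Hm [measurable]: "H \<in> borel_measurable (time_space T M)"
    unfolding H_def time_space_def by measurable
  have V_eq: "V = ae_class (time_space T M) H"
    unfolding V_def tensor_def Lp_add_ae_class[OF tm] by (simp add: H_def[abs_def] case_prod_unfold)
  have V: "V \<in> Lp ?q (time_space T M)"
    unfolding V_def
    by (rule Lp_add_in_Lp[OF q tensor_in_Lp[OF M.sigma_finite_measure_axioms q f(2) Y(1)] tensor_in_Lp[OF M.sigma_finite_measure_axioms q f(1) Y(2)]])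
  have VH: "AE z in time_space T M. rep V z = H z"
    unfolding V_eq by (rule rep_ae_class(2)[OF Hm])
  have H: "H \<in> Lp_fun ?q (time_space T M)"
    by (rule Lp_fun_cong_AE[OF rep_Lp(1)[OF V] Hm]) (use VH in \<open>auto elim!: eventually_mono\<close>)
  note [measurable] = U_measurable_time_space V[THEN rep_measurable]
  have UH: "integrable (?I \<Otimes>\<^sub>M M) (\<lambda>z. U z * H z)"
    using Holder_integrable[OF p U_in_Lp_fun_time_space H] by (simp add: time_space_def)
  have "(\<integral>z. U z * rep V z \<partial>time_space T M) = (\<integral>z. U z * H z \<partial>time_space T M)"
    by (rule integral_cong_AE) (use VH in \<open>auto elim!: eventually_mono\<close>)
  also have "\<dots> = (\<integral>t. (\<integral>x. U (t, x) * H (t, x) \<partial>M) \<partial>?I)"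
    using integral_fst'[OF UH] by (simp add: time_space_def)
  also have "\<dots> = (\<integral>t. f' t * Lp_pairing M (u t) Y + f t * Lp_pairing M (u t) Z \<partial>?I)"
  proof (rule Bochner_Integration.integral_cong[OF refl])
    fix t assume "t \<in> space ?I"
    then have t: "0 \<le> t"
      by (simp add: space_restrict_space)
    have i: "integrable M (\<lambda>x. U (t, x) * rep Y x)" "integrable M (\<lambda>x. U (t, x) * rep Z x)"
      by (intro Holder_integrable[OF p] U_section_Lp_fun t rep_Lp Y)+
    have "(\<integral>x. U (t, x) * H (t, x) \<partial>M) = (\<integral>x. f' t * (U (t, x) * rep Y x) + f t * (U (t, x) * rep Z x) \<partial>M)"
      by (rule Bochner_Integration.integral_cong) (auto simp: H_def algebra_simps)
    also have "\<dots> = f' t * Lp_pairing M (u t) Y + f t * Lp_pairing M (u t) Z"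
      using i by (simp add: pairing_U[OF t Y(1)] pairing_U[OF t Y(2)])
    finally show "(\<integral>x. U (t, x) * H (t, x) \<partial>M) = f' t * Lp_pairing M (u t) Y + f t * Lp_pairing M (u t) Z" .
  qed
  also have "\<dots> = integral {0..T} (\<lambda>t. f' t * Lp_pairing M (u t) Y + f t * Lp_pairing M (u t) Z)"
  proof (rule integral_restrict_Icc)
    have "continuous_on {0..T} (\<lambda>t. Lp_pairing M (u t) Y)" "continuous_on {0..T} (\<lambda>t. Lp_pairing M (u t) Z)"
      by (auto intro: continuous_on_subset[OF pairing_continuous[OF Y(1)]]
          continuous_on_subset[OF pairing_continuous[OF Y(2)]])
    then show "continuous_on {0..T} (\<lambda>t. f' t * Lp_pairing M (u t) Y + f t * Lp_pairing M (u t) Z)"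
      by (intro continuous_on_add continuous_on_mult f)
  qed
  finally show ?thesis .
qed

text \<open>By \<open>weak\<close>, the integrand in time is the derivative of
  \<open>f t * Lp_pairing M (u t) Y\<close>. The boundary term at \<open>T\<close> vanishes because
  \<open>f T = 0\<close>, which leaves only the one at 0.\<close>

lemma integral_time_space_weak_solution:
  assumes T: "0 \<le> T" and f: "C1_with_deriv T f f'" "f T = 0"
    and Y: "Y \<in> Lp (conj_exp p) M" "Z \<in> Lp (conj_exp p) M"
    and weak: "\<And>t. 0 \<le> t \<Longrightarrow>
      Lp_pairing M (u t) Y - Lp_pairing M (u 0) Y = integral {0..t} (\<lambda>s. Lp_pairing M (u s) Z)"
  defines "V \<equiv> Lp_add (time_space T M) (tensor T M f' Y) (tensor T M f Z)"
  shows "(\<integral>z. U z * rep V z \<partial>time_space T M) = - f 0 * Lp_pairing M (u 0) Y"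
proof -
  let ?g = "\<lambda>t. Lp_pairing M (u t) Y" and ?k = "\<lambda>t. Lp_pairing M (u t) Z"
  have fd: "(f has_real_derivative f' t) (at t within {0..T})" if "t \<in> {0..T}" for t
    using f(1) that by (simp add: C1_with_deriv_def)
  have fc: "continuous_on {0..T} f" "continuous_on {0..T} f'"
    using f(1) DERIV_continuous_on[OF fd] by (auto simp: C1_with_deriv_def)
  have kc: "continuous_on {0..T} ?k"
    by (rule continuous_on_subset[OF pairing_continuous[OF Y(2)]]) auto
  \<comment> \<open>\<open>weak\<close> presents the pairing with \<open>Y\<close> as an indefinite
    integral of a continuous function, so it is differentiable, one-sidedly at the end
    points.\<close>
  have gd: "(?g has_real_derivative ?k t) (at t within {0..T})" if t: "t \<in> {0..T}" for t
  proof -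
    have "((\<lambda>x. ?g 0 + integral {0..x} ?k) has_real_derivative ?k t) (at t within {0..T})"
      using DERIV_add[OF DERIV_const integral_has_real_derivative[OF kc t], of "?g 0"] by simp
    moreover have "?g 0 + integral {0..x} ?k = ?g x" if "x \<in> {0..T}" for x
      using weak[of x] that by simp
    ultimately show ?thesis
      by (rule has_field_derivative_transform_within[OF _ zero_less_one t])
  qed
  have "((\<lambda>t. f' t * ?g t + f t * ?k t) has_integral f T * ?g T - f 0 * ?g 0) {0..T}"
  proof (rule fundamental_theorem_of_calculus[OF T])
    fix t assume t: "t \<in> {0..T}"
    show "((\<lambda>t. f t * ?g t) has_vector_derivative f' t * ?g t + f t * ?k t) (at t within {0..T})"
      unfolding has_real_derivative_iff_has_vector_derivative[symmetric]
      using DERIV_mult[OF fd[OF t] gd[OF t]] by (simp add: mult.commute)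
  qed
  then show ?thesis
    unfolding V_def integral_time_space_tensor[OF fc Y] using f(2) by (simp add: integral_unique)
qed

end

section \<open>Agreement of the semigroups and of their generators\<close>

lemma semigroups_agree:
  assumes S1: "Lp_semigroup M p S1" and S2: "Lp_semigroup M p S2"
    and L0: "Lp_linear_on (conj_exp p) M D0 L0"
    and dense: "\<And>T. 0 < T \<Longrightarrow> Lp_dense (conj_exp p) (time_space T M)
           (Lp_span (conj_exp p) (time_space T M) (parabolic_test_set T M L0 D0))"
    and adj1: "op_graph D0 L0 \<subseteq> Lp_adjoint p M (semigroup_generator p M S1)"
    and adj2: "op_graph D0 L0 \<subseteq> Lp_adjoint p M (semigroup_generator p M S2)"
    and X: "X \<in> Lp p M" and t0: "0 \<le> t0"
  shows "S1 t0 X = S2 t0 X"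
proof -
  interpret S1: Lp_semigroup M p S1 by fact
  interpret S2: Lp_semigroup M p S2 by fact
  interpret u1: Lp_curve M p "\<lambda>t. S1 t X"
    by (rule S1.curve[OF X])
  interpret u2: Lp_curve M p "\<lambda>t. S2 t X"
    by (rule S2.curve[OF X])
  obtain U1 where "U1 \<in> borel_measurable (borel \<Otimes>\<^sub>M M)" "\<And>t. 0 \<le> t \<Longrightarrow> AE x in M. U1 (t, x) = rep (S1 t X) x"
    using u1.joint_version by blast
  then interpret u1: Lp_curve_version M p "\<lambda>t. S1 t X" U1
    by unfold_locales
  obtain U2 where "U2 \<in> borel_measurable (borel \<Otimes>\<^sub>M M)" "\<And>t. 0 \<le> t \<Longrightarrow> AE x in M. U2 (t, x) = rep (S2 t X) x"
    using u2.joint_version by blast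
  then interpret u2: Lp_curve_version M p "\<lambda>t. S2 t X" U2
    by unfold_locales
  \<comment> \<open>\<open>eq_if_AE_eq\<close> needs room to the right of \<open>t0\<close>, so the
    time horizon is put beyond it.\<close>
  define T where "T = t0 + 1"
  have T: "0 < T" "t0 < T"
    using t0 by (auto simp: T_def)
  let ?I = "restrict_space lborel {0..T} :: real measure" and ?N = "time_space T M" and ?q = "conj_exp p"
  interpret M: sigma_finite_measure M
    by (rule S1.sigma_finite_M)
  interpret I: finite_measure ?I
    by (rule finite_measure_restrict_lborel_Icc)
  interpret pair_sigma_finite ?I M ..
  have q: "1 \<le> ?q"
    using conj_exp_gt_1[OF S1.p] by simp
  note W1 = u1.U_in_Lp_fun_time_space[of T] and W2 = u2.U_in_Lp_fun_time_space[of T]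
  have G: "parabolic_test_set T M L0 D0 \<subseteq> Lp ?q ?N"
    by (rule parabolic_test_set_subset_Lp[OF S1.sigma_finite_M q L0])
  have "AE z in ?N. U1 z - U2 z = 0"
  proof (rule Lp_dense_annihilator[OF S1.p Lp_fun_diff[OF S1.p1 W1 W2] G dense[OF T(1)]])
    fix V assume V: "V \<in> parabolic_test_set T M L0 D0"
    then obtain \<phi> f f' where V_eq: "V = Lp_add ?N (tensor T M f' \<phi>) (tensor T M f (L0 \<phi>))"
      and \<phi>: "\<phi> \<in> D0" and f: "C1_with_deriv T f f'" "f T = 0"
      by (auto simp: parabolic_test_set_def)
    have L: "\<phi> \<in> Lp ?q M" "L0 \<phi> \<in> Lp ?q M"
      using \<phi> L0 by (auto simp: Lp_linear_on_def Lp_subspace_def)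
    have adj: "(\<phi>, L0 \<phi>) \<in> Lp_adjoint p M (semigroup_generator p M S1)"
      "(\<phi>, L0 \<phi>) \<in> Lp_adjoint p M (semigroup_generator p M S2)"
      using adj1 adj2 \<phi> by (auto simp: op_graph_def)
    \<comment> \<open>Both semigroups start at \<open>X\<close>, so this value and the one for
      \<open>U2\<close> below are the same, and their difference vanishes.\<close>
    have "(\<integral>z. U1 z * rep V z \<partial>?N) = - f 0 * Lp_pairing M (S1 0 X) \<phi>"
      unfolding V_eq using T(1)
      by (intro u1.integral_time_space_weak_solution f L)
        (simp_all add: S1.semigroup_zero[OF X] S1.pairing_semigroup[OF X _ adj(1)])
    moreover have "(\<integral>z. U2 z * rep V z \<partial>?N) = - f 0 * Lp_pairing M (S2 0 X) \<phi>"
      unfolding V_eq using T(1)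
      by (intro u2.integral_time_space_weak_solution f L)
        (simp_all add: S2.semigroup_zero[OF X] S2.pairing_semigroup[OF X _ adj(2)])
    moreover have "V \<in> Lp ?q ?N"
      using V G by blast
    note Holder_integrable[OF S1.p W1 rep_Lp(1)[OF this]] Holder_integrable[OF S1.p W2 rep_Lp(1)[OF this]]
    ultimately show "(\<integral>z. (U1 z - U2 z) * rep V z \<partial>?N) = 0"
      by (simp add: left_diff_distrib S1.semigroup_zero[OF X] S2.semigroup_zero[OF X])
  qed
  \<comment> \<open>A null set of the product has null sections for almost every time. The remaining
    exceptional times are removed at the end by continuity of the orbits.\<close>
  then have "AE t in ?I. AE x in M. U1 (t, x) - U2 (t, x) = 0"
    unfolding time_space_def by (rule AE_pair)
  moreover have "AE t in ?I. 0 \<le> t"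
    by (rule AE_I2) (simp add: space_restrict_space)
  ultimately have "AE t in ?I. S1 t X = S2 t X"
  proof eventually_elim
    case (elim t)
    have "AE x in M. rep (S1 t X) x = rep (S2 t X) x"
      using elim(1) u1.U_version[OF elim(2)] u2.U_version[OF elim(2)] by eventually_elim simp
    then have "ae_class M (rep (S1 t X)) = ae_class M (rep (S2 t X))"
      using elim(2) X by (subst ae_class_eq_iff) (auto intro!: rep_measurable S1.in_Lp S2.in_Lp)
    then show ?case
      using elim(2) X by (simp add: rep_Lp(2)[OF S1.in_Lp] rep_Lp(2)[OF S2.in_Lp])
  qed
  then show ?thesis
    by (rule u1.eq_if_AE_eq[OF u2.Lp_curve_axioms t0 T(2)])
qed

text \<open>The limit at 0 from the right sees only positive times and vectors of
  \<open>Lp p M\<close>. Equality of \<open>S1\<close> and \<open>S2\<close> as total functions is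
  not to be expected, since \<open>C0_semigroup\<close> says nothing about their other
  values.\<close>

lemma semigroup_generator_cong:
  assumes "\<And>t X. 0 \<le> t \<Longrightarrow> X \<in> Lp p M \<Longrightarrow> S1 t X = S2 t X"
  shows "semigroup_generator p M S1 = semigroup_generator p M S2"
proof -
  have "limitin (Lp_topology p M) (\<lambda>h. Lp_scale M (1 / h) (Lp_diff M (S1 h X) X)) Y (at_right 0) \<longleftrightarrow>
      limitin (Lp_topology p M) (\<lambda>h. Lp_scale M (1 / h) (Lp_diff M (S2 h X) X)) Y (at_right 0)"
    if "X \<in> Lp p M" for X Y
  proof -
    have "\<forall>\<^sub>F h in at_right (0 :: real). S1 h X = S2 h X"
      using eventually_at_right_less[of "0 :: real"] by eventually_elim (use assms that in auto)
    then have "\<forall>\<^sub>F h in at_right 0. Lp_scale M (1 / h) (Lp_diff M (S1 h X) X) = Lp_scale M (1 / h) (Lp_diff M (S2 h X) X)"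
      "\<forall>\<^sub>F h in at_right 0. Lp_scale M (1 / h) (Lp_diff M (S2 h X) X) = Lp_scale M (1 / h) (Lp_diff M (S1 h X) X)"
      by (auto elim!: eventually_mono)
    from this[THEN limitin_transform_eventually] show ?thesis
      by blast
  qed
  then show ?thesis
    by (auto simp: semigroup_generator_def)
qed

theorem proposition2p1:
  fixes M :: "'a measure" and p :: real
    and D0 :: "('a \<Rightarrow> real) set set" and L0 :: "('a \<Rightarrow> real) set \<Rightarrow> ('a \<Rightarrow> real) set"
  assumes "sigma_finite_measure M" and "1 < p"
    and "Lp_subspace (conj_exp p) M D0" and "Lp_dense (conj_exp p) M D0"
    and "Lp_linear_on (conj_exp p) M D0 L0"
    and "\<forall>T>0. Lp_dense (conj_exp p) (time_space T M)
           (Lp_span (conj_exp p) (time_space T M) (parabolic_test_set T M L0 D0))"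
  shows "\<exists>\<^sub>\<le>\<^sub>1 L. L \<in> generator_extensions p M L0 D0"
proof (rule Uniq_I)
  fix L1 L2
  assume "L1 \<in> generator_extensions p M L0 D0" "L2 \<in> generator_extensions p M L0 D0"
  then obtain S1 S2
    where S: "C0_semigroup p M S1" "C0_semigroup p M S2"
      and L: "L1 = semigroup_generator p M S1" "L2 = semigroup_generator p M S2"
      and adj: "op_graph D0 L0 \<subseteq> Lp_adjoint p M L1" "op_graph D0 L0 \<subseteq> Lp_adjoint p M L2"
    by (auto simp: generator_extensions_def is_generator_def)
  have sg: "Lp_semigroup M p S1" "Lp_semigroup M p S2"
    using assms(1,2) S by (simp_all add: Lp_semigroup_def)
  show "L1 = L2"
    unfolding L
  proof (rule semigroup_generator_cong)
    fix t :: real and X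
    assume "0 \<le> t" "X \<in> Lp p M"
    then show "S1 t X = S2 t X"
      using assms(6) by (intro semigroups_agree[OF sg assms(5) _ adj[unfolded L]]) blast+
  qed
qed

end
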